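(* Let $\mathcal{H}$ be a complex Hilbert space, let $N\geqslant 2$, and let $A_1,\ldots,A_N$ be bounded self-adjoint operators in $\mathcal{H}$ such that $A_iA_j$ is compact for all $i\neq j$. Let $A=\sum_{i=1}^N A_i$, and for $\varepsilon\geqslant 0$ let $$\mathcal{H}_\varepsilon=\bigcap_{i=1}^N E_{A_i}([-\varepsilon,\varepsilon])\mathcal{H}.$$ Then $0\in\sigma_e(A)$ if and only if the subspace $\mathcal{H}_\varepsilon$ is infinite dimensional for every $\varepsilon>0$.
   Context: For a bounded self-adjoint operator $B$ in $\mathcal{H}$, $E_B(\cdot)$ denotes its projection-valued spectral measure (on Borel subsets of $\mathbb{R}$), and $\sigma(B)$ its spectrum. The essential spectrum $\sigma_e(B)$ is the set of all $\lambda\in\sigma(B)$ such that either $\lambda$ is a limit point of $\sigma(B)$ or $\mathrm{Ker}(B-\lambda I)$ is infinite-dimensional. *)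

theory Defs
  imports "HOL-Analysis.Analysis"
begin

text \<open>The inner product is linear in its first argument. Its positive definiteness is contained in
  \<open>cinner_self\<close>, which also ties it to the (complete) norm of \<^class>\<open>banach\<close>.\<close>

class complex_hilbert_space = banach +
  fixes scaleC :: "complex \<Rightarrow> 'a \<Rightarrow> 'a" (infixr \<open>*\<^sub>C\<close> 75)
    and cinner :: "'a \<Rightarrow> 'a \<Rightarrow> complex"
  assumes scaleC_add_right: "c *\<^sub>C (x + y) = c *\<^sub>C x + c *\<^sub>C y"
    and scaleC_add_left: "(c + d) *\<^sub>C x = c *\<^sub>C x + d *\<^sub>C x"
    and scaleC_scaleC: "c *\<^sub>C d *\<^sub>C x = (c * d) *\<^sub>C x"
    and scaleC_of_real: "complex_of_real r *\<^sub>C x = r *\<^sub>R x"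
    and cinner_commute: "cinner x y = cnj (cinner y x)"
    and cinner_add_left: "cinner (x + y) z = cinner x z + cinner y z"
    and cinner_scaleC_left: "cinner (c *\<^sub>C x) y = c * cinner x y"
    and cinner_self: "cinner x x = complex_of_real ((norm x)\<^sup>2)"

global_interpretation complex_vector:
  vector_space "scaleC :: complex \<Rightarrow> 'a \<Rightarrow> 'a::complex_hilbert_space"
proof
  show "1 *\<^sub>C x = x" for x :: 'a
    using scaleC_of_real[of 1 x] by simp
qed (simp_all add: scaleC_add_right scaleC_add_left scaleC_scaleC)

definition infinite_dimensional :: "'a::complex_hilbert_space set \<Rightarrow> bool" where
  "infinite_dimensional S \<longleftrightarrow> \<not> (\<exists>B. finite B \<and> S \<subseteq> complex_vector.span B)"

definition bounded_clinear :: "('a::complex_hilbert_space \<Rightarrow> 'a) \<Rightarrow> bool" where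
  "bounded_clinear T \<longleftrightarrow> bounded_linear T \<and> (\<forall>c x. T (c *\<^sub>C x) = c *\<^sub>C T x)"

definition bounded_selfadjoint :: "('a::complex_hilbert_space \<Rightarrow> 'a) \<Rightarrow> bool" where
  "bounded_selfadjoint T \<longleftrightarrow> bounded_clinear T \<and> (\<forall>x y. cinner (T x) y = cinner x (T y))"

definition compact_operator :: "('a::complex_hilbert_space \<Rightarrow> 'a) \<Rightarrow> bool" where
  "compact_operator T \<longleftrightarrow> bounded_clinear T \<and> compact (closure (T ` cball 0 1))"

definition spectrum :: "('a::complex_hilbert_space \<Rightarrow> 'a) \<Rightarrow> complex set" where
  "spectrum T = {z. \<not> (\<exists>R. bounded_clinear R \<and>
     (\<forall>x. R (T x - z *\<^sub>C x) = x) \<and> (\<forall>x. T (R x) - z *\<^sub>C R x = x))}"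

definition essential_spectrum :: "('a::complex_hilbert_space \<Rightarrow> 'a) \<Rightarrow> complex set" where
  "essential_spectrum T = {z \<in> spectrum T.
     z islimpt spectrum T \<or> infinite_dimensional {x. T x - z *\<^sub>C x = 0}}"

definition orthogonal_projection :: "('a::complex_hilbert_space \<Rightarrow> 'a) \<Rightarrow> bool" where
  "orthogonal_projection P \<longleftrightarrow> bounded_selfadjoint P \<and> (\<forall>x. P (P x) = P x)"

text \<open>Countable additivity is with respect to the strong operator topology. Only the values on Borel
  sets matter.\<close>

definition projection_valued_measure ::
    "(real set \<Rightarrow> 'a::complex_hilbert_space \<Rightarrow> 'a) \<Rightarrow> bool" where
  "projection_valued_measure E \<longleftrightarrow>
     (\<forall>S\<in>sets borel. orthogonal_projection (E S)) \<and>
     (\<forall>x. E UNIV x = x) \<and>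
     (\<forall>S\<in>sets borel. \<forall>T\<in>sets borel. \<forall>x. E (S \<inter> T) x = E S (E T x)) \<and>
     (\<forall>F :: nat \<Rightarrow> real set. range F \<subseteq> sets borel \<longrightarrow> disjoint_family F \<longrightarrow>
        (\<forall>x. (\<lambda>n. E (F n) x) sums E (\<Union>n. F n) x))"

text \<open>The scalar measure \<open>S \<mapsto> \<langle>E S x, x\<rangle> = \<parallel>E S x\<parallel>\<^sup>2\<close>.\<close>

definition scalar_measure ::
    "(real set \<Rightarrow> 'a::complex_hilbert_space \<Rightarrow> 'a) \<Rightarrow> 'a \<Rightarrow> real measure" where
  "scalar_measure E x = measure_of UNIV (sets borel) (\<lambda>S. ennreal ((norm (E S x))\<^sup>2))"

text \<open>\<open>T = \<integral>t dE(t)\<close> for a boundedly supported \<open>E\<close>. The integral is understood weakly; by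
  polarization it suffices to give the quadratic form. Bounded support, which holds for the spectral
  measure of every bounded operator, makes \<open>t\<close> integrable, so that the Bochner integral never takes
  its default value 0.\<close>

definition is_spectral_measure ::
    "('a::complex_hilbert_space \<Rightarrow> 'a) \<Rightarrow> (real set \<Rightarrow> 'a \<Rightarrow> 'a) \<Rightarrow> bool" where
  "is_spectral_measure T E \<longleftrightarrow> projection_valued_measure E \<and>
     (\<exists>M. \<forall>x. E {-M..M} x = x) \<and>
     (\<forall>x. cinner (T x) x = complex_of_real (\<integral>t. t \<partial>scalar_measure E x))"

text \<open>By the spectral theorem such an \<open>E\<close> exists for every bounded self-adjoint \<open>T\<close>, and its values
  on Borel sets are unique; they do not depend on the choice made here.\<close>

definition spectral_measure ::
    "('a::complex_hilbert_space \<Rightarrow> 'a) \<Rightarrow> real set \<Rightarrow> 'a \<Rightarrow> 'a" where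
  "spectral_measure T = (SOME E. is_spectral_measure T E)"

definition small_spectral_subspace ::
    "nat \<Rightarrow> (nat \<Rightarrow> 'a::complex_hilbert_space \<Rightarrow> 'a) \<Rightarrow> real \<Rightarrow> 'a set" where
  "small_spectral_subspace N A \<epsilon> = (\<Inter>i\<in>{1..N}. range (spectral_measure (A i) {-\<epsilon>..\<epsilon>}))"

end

theory Submission
  imports Defs "HOL-Probability.Probability"
begin

text \<open>The projection-valued spectral measure of \<open>0 \<le> T \<le> 1\<close> comes from the Hausdorff moment problem: the
  operators \<open>T\<^sup>k (1 - T)\<^sup>m\<close> are positive, so for each \<open>x\<close> the Bernstein weights
  \<open>(n choose k) \<langle>T\<^sup>k (1 - T)\<^bsup>n-k\<^esup> x, x\<rangle>\<close> at the points \<open>k / n\<close> form discrete measures, and a weak limit of them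
  has the moments \<open>\<langle>T\<^sup>k x, x\<rangle>\<close>. As measures on the unit interval are determined by their moments,
  every algebraic property of the projections reduces to an identity between powers of \<open>T\<close>.

  If \<open>0\<close> is in the essential spectrum of \<open>A = \<Sum> A\<^sub>i\<close>, then for every finite set \<open>G\<close> there is a unit vector
  \<open>x\<close> orthogonal to \<open>G\<close> with \<open>A x\<close> small. As \<open>A\<^sub>j A = A\<^sub>j\<^sup>2 + compact\<close>, all \<open>A\<^sub>j x\<close> are small, so \<open>x\<close> is
  almost orthogonal to the spectral subspaces of the \<open>A\<^sub>j\<close> away from zero. Since the products \<open>A\<^sub>i A\<^sub>j\<close> are
  compact, these subspaces are almost orthogonal to each other up to finite dimension, so \<open>x\<close> is almost
  orthogonal to (nearly) their whole sum. If the orthogonal complement of that sum, which is \<open>\<H>\<^sub>\<epsilon>\<close> up to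
  finite dimension, had finite dimension, then choosing \<open>x\<close> orthogonal to it would give \<open>x = 0\<close>.
  Conversely, \<open>\<parallel>A x\<parallel> \<le> N \<epsilon> \<parallel>x\<parallel>\<close> on \<open>\<H>\<^sub>\<epsilon>\<close>, whereas \<open>0\<close> outside the essential spectrum would make \<open>A\<close>
  bounded below on a subspace of finite codimension.\<close>

section \<open>Moments of measures on the unit interval\<close>

text \<open>Pascal's rule, in the shape in which the two halves of the recursion for
  \<open>L\<close> can be recombined.\<close>

lemma sum_binomial_Suc:
  fixes h :: "nat \<Rightarrow> real"
  shows "(\<Sum>k\<le>Suc n. real (Suc n choose k) * h k) =
    (\<Sum>k\<le>n. real (n choose k) * h (Suc k)) + (\<Sum>k\<le>n. real (n choose k) * h k)"
proof -
  have "(\<Sum>k\<le>Suc n. real (Suc n choose k) * h k) = h 0 + (\<Sum>k\<le>n. real (Suc n choose Suc k) * h (Suc k))"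
    by (subst sum.atMost_Suc_shift) simp
  also have "\<dots> = (\<Sum>k\<le>n. real (n choose k) * h (Suc k)) + (h 0 + (\<Sum>k\<le>n. real (n choose Suc k) * h (Suc k)))"
    by (simp add: distrib_right sum.distrib)
  also have "h 0 + (\<Sum>k\<le>n. real (n choose Suc k) * h (Suc k)) = (\<Sum>k\<le>Suc n. real (n choose k) * h k)"
    by (subst sum.atMost_Suc_shift) simp
  finally show ?thesis by simp
qed

text \<open>\<open>L k m\<close> plays the role of the integral of \<open>t\<^sup>k (1 - t)\<^sup>m\<close>.\<close>

lemma sum_binomial_moments:
  fixes L :: "nat \<Rightarrow> nat \<Rightarrow> real"
  assumes rec: "\<And>k m. L k m = L (Suc k) m + L k (Suc m)"
  shows "(\<Sum>k\<le>n. real (n choose k) * L (i + k) (n - k + m)) = L i m"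
proof (induction n arbitrary: i m)
  case (Suc n)
  have "(\<Sum>k\<le>Suc n. real (Suc n choose k) * L (i + k) (Suc n - k + m)) =
     (\<Sum>k\<le>n. real (n choose k) * L (Suc i + k) (n - k + m)) +
     (\<Sum>k\<le>n. real (n choose k) * L (i + k) (n - k + Suc m))"
    unfolding sum_binomial_Suc by (simp add: Suc_diff_le)
  also have "\<dots> = L i m"
    by (simp only: Suc.IH rec[of i m])
  finally show ?case .
qed simp

text \<open>Induction on the exponent: a factor \<open>k / n\<close> is absorbed into the binomial
  coefficient, which lowers the exponent by one and raises the first index of \<open>L\<close>;
  hence the arbitrary offset \<open>i\<close>. The price is that the nodes become (k + 1) / (n + 1)
  instead of k / n, an error of order 1 / n times the total mass.\<close>

lemma bernstein_moments_tendsto: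
  fixes L :: "nat \<Rightarrow> nat \<Rightarrow> real"
  assumes rec: "\<And>k m. L k m = L (Suc k) m + L k (Suc m)" and nonneg: "\<And>k m. 0 \<le> L k m"
  shows "(\<lambda>n. \<Sum>k\<le>n. (real k / real n) ^ j * (real (n choose k) * L (i + k) (n - k))) \<longlonglongrightarrow> L (i + j) 0"
proof (induction j arbitrary: i)
  case 0
  then show ?case
    using sum_binomial_moments[of L n i 0 for n, OF rec] by simp
next
  case (Suc j)
  define S where "S n = (\<Sum>k\<le>n. (real k / real n) ^ j * (real (n choose k) * L (Suc i + k) (n - k)))" for n
  define R where "R n = (\<Sum>k\<le>n. (real k / real n) ^ Suc j * (real (n choose k) * L (i + k) (n - k)))" for n
  \<comment> \<open>The term for k = 0 vanishes because the exponent is positive; in the others (k +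
    1) / (n + 1) times the binomial coefficient of n + 1 and k + 1 is that of n and k.\<close>
  have R_Suc: "R (Suc n) = (\<Sum>k\<le>n. (real (Suc k) / real (Suc n)) ^ j * (real (n choose k) * L (Suc i + k) (n - k)))" for n
  proof -
    have "R (Suc n) = (\<Sum>k\<le>n. (real (Suc k) / real (Suc n)) ^ Suc j * (real (Suc n choose Suc k) * L (i + Suc k) (n - k)))"
      unfolding R_def by (subst sum.atMost_Suc_shift) simp
    also have "\<dots> = (\<Sum>k\<le>n. (real (Suc k) / real (Suc n)) ^ j * (real (n choose k) * L (Suc i + k) (n - k)))"
    proof (intro sum.cong refl)
      fix k
      have "real (Suc k) * real (Suc n choose Suc k) = real (Suc n) * real (n choose k)"
        using Suc_times_binomial[of k n] by (metis of_nat_mult)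
      then have "real (Suc k) / real (Suc n) * real (Suc n choose Suc k) = real (n choose k)"
        by (simp add: field_simps)
      moreover have "q ^ Suc j * (b * l) = q ^ j * ((q * b) * l)" for q b l :: real
        by simp
      ultimately show "(real (Suc k) / real (Suc n)) ^ Suc j * (real (Suc n choose Suc k) * L (i + Suc k) (n - k)) =
          (real (Suc k) / real (Suc n)) ^ j * (real (n choose k) * L (Suc i + k) (n - k))"
        by (simp only: add_Suc add_Suc_right)
    qed
    finally show ?thesis .
  qed
  have bound: "\<bar>R (Suc n) - S n\<bar> \<le> real j / real (Suc n) * L (Suc i) 0" for n
  proof -
    have "\<bar>R (Suc n) - S n\<bar> = \<bar>\<Sum>k\<le>n. ((real (Suc k) / real (Suc n)) ^ j - (real k / real n) ^ j) * (real (n choose k) * L (Suc i + k) (n - k))\<bar>"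
      unfolding R_Suc S_def by (simp add: sum_subtractf left_diff_distrib)
    also have "\<dots> \<le> (\<Sum>k\<le>n. real j / real (Suc n) * (real (n choose k) * L (Suc i + k) (n - k)))"
    proof (rule sum_abs[THEN order_trans], rule sum_mono)
      fix k assume k: "k \<in> {..n}"
      \<comment> \<open>The power with exponent j is Lipschitz with constant j on the unit
        interval.\<close>
      have "\<bar>(real (Suc k) / real (Suc n)) ^ j - (real k / real n) ^ j\<bar>
          \<le> real j * \<bar>real (Suc k) / real (Suc n) - real k / real n\<bar>"
        using norm_power_diff[of "real (Suc k) / real (Suc n)" "real k / real n" j] k
        by (auto simp: divide_le_eq_1)
      also have "\<dots> \<le> real j * (1 / real (Suc n))"
      proof (intro mult_left_mono)
        show "\<bar>real (Suc k) / real (Suc n) - real k / real n\<bar> \<le> 1 / real (Suc n)"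
        \<comment> \<open>For n = 0 only k = 0 occurs, and 0 / 0 = 0 makes the difference exactly
          1.\<close>
        proof (cases "n = 0")
          case False
          then have "real (Suc k) / real (Suc n) - real k / real n = ((real n - real k) / real n) * (1 / real (Suc n))"
            by (simp add: field_simps)
          moreover have "0 \<le> (real n - real k) / real n" "(real n - real k) / real n \<le> 1"
            using k False by auto
          ultimately show ?thesis
            by (simp only: abs_of_nonneg mult_left_le_one_le mult_nonneg_nonneg zero_le_divide_1_iff of_nat_0_le_iff)
        qed (use k in auto)
      qed auto
      finally have "\<bar>(real (Suc k) / real (Suc n)) ^ j - (real k / real n) ^ j\<bar> \<le> real j / real (Suc n)"
        by simp
      moreover have "0 \<le> real (n choose k) * L (Suc i + k) (n - k)"
        using nonneg by simp
      ultimately show "\<bar>((real (Suc k) / real (Suc n)) ^ j - (real k / real n) ^ j) * (real (n choose k) * L (Suc i + k) (n - k))\<bar>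
         \<le> real j / real (Suc n) * (real (n choose k) * L (Suc i + k) (n - k))"
        unfolding abs_mult[of "(real (Suc k) / real (Suc n)) ^ j - (real k / real n) ^ j"]
        by (subst (2) abs_of_nonneg) (assumption | rule mult_right_mono)+
    qed
    also have "\<dots> = real j / real (Suc n) * (\<Sum>k\<le>n. real (n choose k) * L (Suc i + k) (n - k + 0))"
      by (simp only: sum_distrib_left add_0_right)
    also have "\<dots> = real j / real (Suc n) * L (Suc i) 0"
      by (rule arg_cong[OF sum_binomial_moments[of L, OF rec]])
    finally show ?thesis .
  qed
  have "(\<lambda>n. R (Suc n) - S n) \<longlonglongrightarrow> 0"
  proof (rule Lim_null_comparison)
    show "\<forall>\<^sub>F n in sequentially. norm (R (Suc n) - S n) \<le> real j / real (Suc n) * L (Suc i) 0"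
      using bound by simp
    show "(\<lambda>n. real j / real (Suc n) * L (Suc i) 0) \<longlonglongrightarrow> 0"
      by (intro tendsto_mult_left_zero filterlim_compose[OF lim_const_over_n filterlim_Suc])
  qed
  moreover have "S \<longlonglongrightarrow> L (i + Suc j) 0"
    using Suc.IH[of "Suc i"] unfolding S_def by simp
  ultimately have "(\<lambda>n. R (Suc n) - S n + S n) \<longlonglongrightarrow> 0 + L (i + Suc j) 0"
    by (intro tendsto_add)
  then have "R \<longlonglongrightarrow> L (i + Suc j) 0"
    by (simp add: filterlim_sequentially_Suc)
  then show ?case
    unfolding R_def .
qed

text \<open>The measures live on all Borel sets of the line and only their mass is confined to the
  unit interval, so that weak convergence of real distributions applies to them directly.\<close>

definition unit_interval_measure :: "real measure \<Rightarrow> bool" where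
  "unit_interval_measure M \<longleftrightarrow> finite_measure M \<and> sets M = sets borel \<and> (AE t in M. t \<in> {0..1})"

text \<open>Helly selection: the Bernstein weights define probability measures on the nodes k / n,
  which are tight because they sit in the unit interval. A subsequence converges weakly, and
  \<open>bernstein_moments_tendsto\<close> identifies the moments of the limit.\<close>

lemma hausdorff_moment_prob:
  fixes L :: "nat \<Rightarrow> nat \<Rightarrow> real"
  assumes rec: "\<And>k m. L k m = L (Suc k) m + L k (Suc m)" and nonneg: "\<And>k m. 0 \<le> L k m"
    and L00: "L 0 0 = 1"
  obtains M where "real_distribution M" "AE t in M. t \<in> {0..1}" "\<And>j. (\<integral>t. t ^ j \<partial>M) = L j 0"
proof -
  define w where "w n k = real (n choose k) * L k (n - k)" for n k
  have w_nonneg: "0 \<le> w n k" for n k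
    using nonneg by (simp add: w_def)
  have sum_w: "(\<Sum>k\<le>n. w n k) = 1" for n
    using sum_binomial_moments[of L n 0 0, OF rec] L00 by (simp add: w_def)
  define P where "P n = point_measure {..n} (\<lambda>k. ennreal (w n k))" for n :: nat
  define \<mu> where "\<mu> n = distr (P n) borel (\<lambda>k. real k / real n)" for n
  have meas_P: "f \<in> borel_measurable (P n)" for f :: "nat \<Rightarrow> real" and n
    by (simp add: P_def)
  have prob_P: "prob_space (P n)" for n
    by (rule prob_spaceI)
      (simp add: P_def emeasure_point_measure_finite space_point_measure sum_w w_nonneg sum_ennreal)
  have rd: "real_distribution (\<mu> n)" for n
    unfolding \<mu>_def using prob_space.real_distribution_distr[OF prob_P meas_P] .
  have integral_\<mu>: "(\<integral>t. f t \<partial>\<mu> n) = (\<Sum>k\<le>n. w n k * f (real k / real n))" if "f \<in> borel_measurable borel" for f :: "real \<Rightarrow> real" and n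
    unfolding \<mu>_def integral_distr[OF meas_P that] unfolding P_def
    by (subst lebesgue_integral_point_measure_finite) (auto simp: w_nonneg)
  have \<mu>_compl: "measure (\<mu> n) {0..1} = 1" for n
  proof -
    interpret real_distribution "\<mu> n" by (rule rd)
    have "measure (\<mu> n) {0..1} = (\<integral>t. indicator {0..1} t \<partial>\<mu> n)"
      by simp
    also have "\<dots> = (\<Sum>k\<le>n. w n k * indicator {0..1} (real k / real n))"
      by (rule integral_\<mu>) simp
    also have "\<dots> = (\<Sum>k\<le>n. w n k)"
      by (intro sum.cong) (auto simp: indicator_def divide_le_eq_1)
    finally show ?thesis using sum_w by simp
  qed
  have "tight \<mu>"
    unfolding tight_def
  proof (intro conjI allI impI)
    fix \<epsilon> :: real assume "\<epsilon> > 0"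
    \<comment> \<open>Tightness is phrased with half-open intervals; the left end -1 keeps a
      possible atom at 0 inside.\<close>
    have "measure (\<mu> n) {-1<..1} > 1 - \<epsilon>" for n
    proof -
      interpret real_distribution "\<mu> n" by (rule rd)
      have "measure (\<mu> n) {0..1} \<le> measure (\<mu> n) {-1<..1}"
        by (intro finite_measure_mono) auto
      then show ?thesis using \<mu>_compl \<open>\<epsilon> > 0\<close> by (smt (verit))
    qed
    then show "\<exists>a b. a < b \<and> (\<forall>n. 1 - \<epsilon> < measure (\<mu> n) {a<..b})"
      by (intro exI[of _ "-1"] exI[of _ 1]) auto
  qed (rule rd)
  then obtain r M where r: "strict_mono r" and M: "real_distribution M"
    and conv: "weak_conv_m (\<mu> \<circ> id \<circ> r) M"
    using tight_imp_convergent_subsubsequence[of \<mu> id] by (auto simp: strict_mono_def)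
  interpret M: real_distribution M by (rule M)
  have lim: "(\<lambda>n. (\<Sum>k\<le>r n. w (r n) k * f (real k / real (r n)))) \<longlonglongrightarrow> (\<integral>t. f t \<partial>M)"
    if f: "\<And>t. isCont f t" and B: "\<And>t. norm (f t) \<le> B" for f :: "real \<Rightarrow> real" and B
  proof -
    have m: "f \<in> borel_measurable borel"
      using f by (intro borel_measurable_continuous_onI) (auto simp: continuous_on_eq_continuous_at)
    show ?thesis
      using weak_conv_imp_integral_bdd_continuous_conv[OF _ M conv f B] rd
      by (simp add: integral_\<mu>[OF m])
  qed
  \<comment> \<open>Weak convergence tests only bounded functions, and powers are unbounded on the
    line. Clamping the argument makes them bounded without moving the nodes.\<close>
  define clamp :: "real \<Rightarrow> real" where "clamp t = max 0 (min 1 t)" for t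
  have clamp_id: "clamp (real k / real n) = real k / real n" if "k \<le> n" for k n
    proof -
    have "real k / real n \<le> 1" using that by (auto simp: divide_le_eq_1)
    then show ?thesis by (simp add: clamp_def)
  qed
  have moments: "(\<integral>t. clamp t ^ j \<partial>M) = L j 0" for j
  proof (rule LIMSEQ_unique)
    show "(\<lambda>n. (\<Sum>k\<le>r n. w (r n) k * clamp (real k / real (r n)) ^ j)) \<longlonglongrightarrow> (\<integral>t. clamp t ^ j \<partial>M)"
      by (rule lim[of _ 1]) (auto simp: clamp_def power_le_one intro!: continuous_intros)
    have "(\<lambda>n. (\<Sum>k\<le>r n. w (r n) k * clamp (real k / real (r n)) ^ j)) =
      (\<lambda>n. \<Sum>k\<le>n. (real k / real n) ^ j * (real (n choose k) * L (0 + k) (n - k))) \<circ> r"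
      by (auto simp: fun_eq_iff clamp_id w_def mult_ac intro!: sum.cong)
    then show "(\<lambda>n. (\<Sum>k\<le>r n. w (r n) k * clamp (real k / real (r n)) ^ j)) \<longlonglongrightarrow> L j 0"
      using LIMSEQ_subseq_LIMSEQ[OF bernstein_moments_tendsto[of L j 0, OF rec nonneg] r] by simp
  qed
  \<comment> \<open>A bounded continuous function that vanishes exactly on the unit interval. Its
    integral against every approximating measure is 0, hence also against \<open>M\<close>, which
    locates the mass of \<open>M\<close>.\<close>
  define g where "g t = min 1 \<bar>t - clamp t\<bar>" for t
  have g_cont: "isCont g t" for t
    unfolding g_def clamp_def by (intro continuous_intros)
  have [measurable]: "g \<in> borel_measurable borel"
    using g_cont by (intro borel_measurable_continuous_onI) (auto simp: continuous_on_eq_continuous_at)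
  have "(\<integral>t. g t \<partial>M) = 0"
  proof (rule LIMSEQ_unique)
    show "(\<lambda>n. (\<Sum>k\<le>r n. w (r n) k * g (real k / real (r n)))) \<longlonglongrightarrow> (\<integral>t. g t \<partial>M)"
      by (rule lim[OF g_cont, of 1]) (auto simp: g_def)
    show "(\<lambda>n. (\<Sum>k\<le>r n. w (r n) k * g (real k / real (r n)))) \<longlonglongrightarrow> 0"
    proof -
      have "g (real k / real n) = 0" if "k \<le> n" for k n
        using clamp_id[OF that] by (simp add: g_def)
      then have "(\<Sum>k\<le>r n. w (r n) k * g (real k / real (r n))) = 0" for n
        by (intro sum.neutral) auto
      then show ?thesis by simp
    qed
  qed
  moreover have "integrable M g"
    by (rule M.integrable_const_bound[where B = 1]) (auto simp: g_def)
  ultimately have "AE t in M. g t = 0"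
    by (subst (asm) integral_nonneg_eq_0_iff_AE) (auto simp: g_def)
  then have supp: "AE t in M. t \<in> {0..1}"
    by eventually_elim (auto simp: g_def clamp_def split: if_splits)
  have "(\<integral>t. t ^ j \<partial>M) = L j 0" for j
  proof -
    have "(\<integral>t. t ^ j \<partial>M) = (\<integral>t. clamp t ^ j \<partial>M)"
    proof (rule integral_cong_AE)
      show "AE t in M. t ^ j = clamp t ^ j"
        using supp by eventually_elim (simp add: clamp_def)
    qed (auto simp: clamp_def)
    then show ?thesis using moments by simp
  qed
  with M supp show thesis by (rule that)
qed

text \<open>Normalize by the total mass \<open>L 0 0\<close> and scale the resulting probability
  measure back. If the mass is 0, any probability measure on the unit interval can be scaled by
  0.\<close>

lemma hausdorff_moment:
  fixes L :: "nat \<Rightarrow> nat \<Rightarrow> real"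
  assumes rec: "\<And>k m. L k m = L (Suc k) m + L k (Suc m)" and nonneg: "\<And>k m. 0 \<le> L k m"
  obtains M where "unit_interval_measure M" "\<And>j. (\<integral>t. t ^ j \<partial>M) = L j 0"
proof -
  define c where "c = L 0 0"
  have c: "c \<ge> 0" using nonneg by (simp add: c_def)
  obtain M where M: "real_distribution M" "AE t in M. t \<in> {0..1}" "\<And>j. c * (\<integral>t. t ^ j \<partial>M) = L j 0"
  proof (cases "c = 0")
    case True
    \<comment> \<open>Each entry splits into two nonnegative summands, so the vanishing of
      \<open>L 0 0\<close> spreads to all entries by induction on k + m.\<close>
    have "(\<forall>k m. k + m = n \<longrightarrow> L k m = 0)" for n
    proof (induction n)
      case 0
      then show ?case using True by (simp add: c_def)
    next
      case (Suc n)
      have *: "L (Suc k) m = 0 \<and> L k (Suc m) = 0" if "k + m = n" for k m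
        using Suc that rec[of k m] nonneg[of "Suc k" m] nonneg[of k "Suc m"] by auto
      show ?case
      proof (intro allI impI)
        fix k m assume "k + m = Suc n"
        then show "L k m = 0"
          using *[of "k - 1" m] *[of k "m - 1"] by (cases k; cases m) auto
      qed
    qed
    then have "L j 0 = 0" for j by auto
    moreover have "real_distribution (return borel 0)"
      by (simp add: real_distribution_def real_distribution_axioms_def prob_space_return)
    moreover have "AE t in return borel 0. t \<in> {0..1::real}"
      by (subst AE_return) auto
    ultimately show thesis
      using that[of "return borel 0"] True by auto
  next
    case False
    have "L k m / c = L (Suc k) m / c + L k (Suc m) / c" for k m
      using rec[of k m] by (simp add: add_divide_distrib)
    moreover have "0 \<le> L k m / c" for k m
      using nonneg c by simp
    moreover have "L 0 0 / c = 1"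
      using False by (simp add: c_def)
    ultimately obtain M where "real_distribution M" "AE t in M. t \<in> {0..1}" "\<And>j. (\<integral>t. t ^ j \<partial>M) = L j 0 / c"
      by (rule hausdorff_moment_prob[of "\<lambda>k m. L k m / c"]) auto
    then show thesis using that False by auto
  qed
  interpret M: real_distribution M by (rule M)
  define N where "N = density M (\<lambda>_. ennreal c)"
  have "finite_measure N"
    by (rule finite_measureI) (simp add: N_def emeasure_density M.emeasure_space_1 ennreal_mult_eq_top_iff)
  then have "unit_interval_measure N"
    using M(2) by (auto simp: unit_interval_measure_def N_def AE_density)
  moreover have "(\<integral>t. t ^ j \<partial>N) = L j 0" for j
    using M(3)[of j] c by (simp add: N_def integral_density)
  ultimately show thesis by (rule that)
qed

section \<open>Uniqueness: measures on the unit interval are determined by their moments\<close>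

lemma unit_interval_measure_integrable:
  assumes M: "unit_interval_measure M" and f: "f \<in> borel_measurable borel"
    and B: "\<And>t. t \<in> {0..1} \<Longrightarrow> \<bar>f t\<bar> \<le> (B::real)"
  shows "integrable M f"
proof -
  interpret finite_measure M using M by (simp add: unit_interval_measure_def)
  have [measurable_cong]: "sets M = sets borel" using M by (simp add: unit_interval_measure_def)
  show ?thesis
  proof (rule integrable_const_bound)
    have "AE t in M. t \<in> {0..1}" using M by (simp add: unit_interval_measure_def)
    then show "AE t in M. norm (f t) \<le> B"
      by (rule AE_mp) (use B in auto)
  qed (use f in measurable)
qed

text \<open>The moments control all polynomials, and Bernstein polynomials approximate
  \<open>f\<close> uniformly on the unit interval. Linear combinations are treated instead of
  equality of two measures, because the polarized relations needed later involve several measures at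
  once.\<close>

lemma sum_moments_zero_imp_continuous:
  fixes M :: "nat \<Rightarrow> real measure" and c :: "nat \<Rightarrow> real"
  assumes M: "\<And>i. i < n \<Longrightarrow> unit_interval_measure (M i)"
    and moments: "\<And>k. (\<Sum>i<n. c i * (\<integral>t. t ^ k \<partial>M i)) = 0"
    and f: "continuous_on UNIV f"
  shows "(\<Sum>i<n. c i * (\<integral>t. f t \<partial>M i)) = 0"
proof -
  have [measurable]: "f \<in> borel_measurable borel"
    using f by (rule borel_measurable_continuous_onI)
  have int_poly: "integrable (M i) (\<lambda>t. t ^ k * (1 - t) ^ m)" if "i < n" for i k m
    by (rule unit_interval_measure_integrable[OF M[OF that], where B = 1])
      (auto simp: abs_mult power_le_one intro!: mult_le_one)
  have poly0: "(\<Sum>i<n. c i * (\<integral>t. t ^ k * (1 - t) ^ m \<partial>M i)) = 0" for k m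
  proof (induction m arbitrary: k)
    case 0
    then show ?case using moments by simp
  next
    case (Suc m)
    have "(\<integral>t. t ^ k * (1 - t) ^ Suc m \<partial>M i) = (\<integral>t. t ^ k * (1 - t) ^ m \<partial>M i) - (\<integral>t. t ^ Suc k * (1 - t) ^ m \<partial>M i)"
      if "i < n" for i
      by (subst Bochner_Integration.integral_diff[symmetric])
        (use int_poly[OF that, of "Suc k" m] int_poly[OF that, of k m] in
          \<open>auto intro!: Bochner_Integration.integral_cong simp: algebra_simps\<close>)
    then have "(\<Sum>i<n. c i * (\<integral>t. t ^ k * (1 - t) ^ Suc m \<partial>M i)) =
       (\<Sum>i<n. c i * (\<integral>t. t ^ k * (1 - t) ^ m \<partial>M i)) - (\<Sum>i<n. c i * (\<integral>t. t ^ Suc k * (1 - t) ^ m \<partial>M i))"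
      by (simp add: right_diff_distrib sum_subtractf)
    then show ?case using Suc[of k] Suc[of "Suc k"] by simp
  qed
  \<comment> \<open>\<open>K\<close> bounds the total variation of the signed combination, so a
    uniform error \<open>e\<close> changes its integral by at most \<open>K * e\<close>.\<close>
  define K where "K = (\<Sum>i<n. \<bar>c i\<bar> * measure (M i) (space (M i)))"
  have K: "0 \<le> K" by (simp add: K_def sum_nonneg)
  have "\<bar>\<Sum>i<n. c i * (\<integral>t. f t \<partial>M i)\<bar> \<le> K * e" if e: "e > 0" for e
  proof -
    obtain m where m: "\<And>t. t \<in> {0..1} \<Longrightarrow> \<bar>f t - (\<Sum>k\<le>m. f (real k / real m) * Bernstein m k t)\<bar> < e"
      using Bernstein_Weierstrass[OF continuous_on_subset[OF f subset_UNIV] e] by blast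
    define b where "b t = (\<Sum>k\<le>m. f (real k / real m) * Bernstein m k t)" for t
    have b_alt: "b t = (\<Sum>k\<le>m. (f (real k / real m) * real (m choose k)) * (t ^ k * (1 - t) ^ (m - k)))" for t
      by (simp add: b_def Bernstein_def mult_ac)
    have int_b: "(\<integral>t. b t \<partial>M i) = (\<Sum>k\<le>m. (f (real k / real m) * real (m choose k)) * (\<integral>t. t ^ k * (1 - t) ^ (m - k) \<partial>M i))"
      and integ_b: "integrable (M i) b" if "i < n" for i
      unfolding b_alt using int_poly[OF that]
      by (simp_all only: Bochner_Integration.integral_sum Bochner_Integration.integrable_sum
          integrable_mult_right integral_mult_right_zero)
    have [measurable]: "b \<in> borel_measurable borel"
      unfolding b_alt by measurable
    have "(\<Sum>i<n. c i * (\<integral>t. b t \<partial>M i)) =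
        (\<Sum>k\<le>m. (f (real k / real m) * real (m choose k)) * (\<Sum>i<n. c i * (\<integral>t. t ^ k * (1 - t) ^ (m - k) \<partial>M i)))"
      by (simp add: int_b sum_distrib_left mult_ac) (rule sum.swap)
    then have b0: "(\<Sum>i<n. c i * (\<integral>t. b t \<partial>M i)) = 0"
      by (simp add: poly0)
    have diff: "\<bar>(\<integral>t. f t \<partial>M i) - (\<integral>t. b t \<partial>M i)\<bar> \<le> measure (M i) (space (M i)) * e"
      and "i < n" if "i < n" for i
    proof -
      interpret finite_measure "M i" using M[OF that] by (simp add: unit_interval_measure_def)
      have int_d: "integrable (M i) (\<lambda>t. f t - b t)"
        by (rule unit_interval_measure_integrable[OF M[OF that], where B = e])
          (use m in \<open>auto simp flip: b_def intro: less_imp_le\<close>)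
      then have int_f: "integrable (M i) f"
        using Bochner_Integration.integrable_add[OF int_d integ_b[OF that]] by simp
      have "AE t in M i. t \<in> {0..1}"
        using M[OF that] by (simp add: unit_interval_measure_def)
      then have "\<bar>\<integral>t. f t - b t \<partial>M i\<bar> \<le> (\<integral>t. e \<partial>M i)"
        using int_d m by (intro integral_abs_bound[THEN order_trans] integral_mono_AE)
            (auto simp: b_def intro: less_imp_le elim!: AE_mp)
      then show "\<bar>(\<integral>t. f t \<partial>M i) - (\<integral>t. b t \<partial>M i)\<bar> \<le> measure (M i) (space (M i)) * e"
        using int_f integ_b[OF that] by simp
    qed (rule that)
    have "\<bar>\<Sum>i<n. c i * (\<integral>t. f t \<partial>M i)\<bar> = \<bar>\<Sum>i<n. c i * ((\<integral>t. f t \<partial>M i) - (\<integral>t. b t \<partial>M i))\<bar>"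
      using b0 by (simp add: right_diff_distrib sum_subtractf)
    also have "\<dots> \<le> (\<Sum>i<n. \<bar>c i\<bar> * (measure (M i) (space (M i)) * e))"
      by (rule sum_abs[THEN order_trans], rule sum_mono) (simp add: abs_mult diff mult_left_mono)
    finally show ?thesis
      by (simp add: K_def sum_distrib_right sum_distrib_left mult_ac)
  qed
  then have ev: "\<forall>\<^sub>F e in at_right 0. \<bar>\<Sum>i<n. c i * (\<integral>t. f t \<partial>M i)\<bar> \<le> K * e"
    by (auto intro: eventually_at_rightI[of 0 1])
  have "((\<lambda>e. K * e) \<longlongrightarrow> K * 0) (at_right 0)"
    by (intro tendsto_intros)
  then have "\<bar>\<Sum>i<n. c i * (\<integral>t. f t \<partial>M i)\<bar> \<le> K * 0"
    by (rule tendsto_lowerbound[OF _ ev]) simp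
  then show ?thesis by simp
qed

text \<open>Indicators of closed half-lines are limits of continuous piecewise linear steps.
  Half-lines are closed under intersection and generate the Borel sets, while the sets on which the
  combination vanishes form a Dynkin system.\<close>

lemma sum_moments_zero_imp_sets:
  fixes M :: "nat \<Rightarrow> real measure" and c :: "nat \<Rightarrow> real"
  assumes M: "\<And>i. i < n \<Longrightarrow> unit_interval_measure (M i)"
    and moments: "\<And>k. (\<Sum>i<n. c i * (\<integral>t. t ^ k \<partial>M i)) = 0"
    and S: "S \<in> sets borel"
  shows "(\<Sum>i<n. c i * measure (M i) S) = 0"
proof -
  have sets: "sets (M i) = sets borel" and fin: "finite_measure (M i)" if "i < n" for i
    using M[OF that] by (auto simp: unit_interval_measure_def)
  have space: "space (M i) = UNIV" if "i < n" for i
    using sets_eq_imp_space_eq[OF sets[OF that]] by simp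
  have atMost: "(\<Sum>i<n. c i * measure (M i) {..a}) = 0" for a
  proof (rule LIMSEQ_unique)
    define g where "g m = cts_step a (a + 1 / real (Suc m))" for m
    have cont: "continuous_on UNIV (g m)" for m
      unfolding g_def by (intro uniformly_continuous_imp_continuous cts_step_uniformly_continuous) simp
    have [measurable]: "g m \<in> borel_measurable borel" for m
      using cont by (rule borel_measurable_continuous_onI)
    have step_le: "\<bar>cts_step a b t\<bar> \<le> 1" if "a < b" for b t
      using that by (auto simp: cts_step_def divide_le_eq_1)
    have g_lim: "(\<lambda>m. g m t) \<longlonglongrightarrow> indicator {..a} t" for t
    proof (cases "t \<le> a")
      case True
      then show ?thesis by (simp add: g_def cts_step_def)
    next
      case False
      have "\<forall>\<^sub>F m in sequentially. 1 / real (Suc m) < t - a"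
        using False by (intro order_tendstoD[OF filterlim_compose[OF lim_1_over_n filterlim_Suc]]) simp
      then have "\<forall>\<^sub>F m in sequentially. g m t = 0"
        by eventually_elim (use False in \<open>auto simp: g_def cts_step_def\<close>)
      then show ?thesis using False by (simp add: tendsto_eventually)
    qed
    show "(\<lambda>m. \<Sum>i<n. c i * (\<integral>t. g m t \<partial>M i)) \<longlonglongrightarrow> (\<Sum>i<n. c i * measure (M i) {..a})"
    proof (intro tendsto_sum tendsto_mult tendsto_const)
      fix i assume "i \<in> {..<n}"
      then have i: "i < n" by simp
      interpret finite_measure "M i" by (rule fin[OF i])
      have [measurable_cong]: "sets (M i) = sets borel" by (rule sets[OF i])
      have "(\<lambda>m. \<integral>t. g m t \<partial>M i) \<longlonglongrightarrow> (\<integral>t. indicator {..a} t \<partial>M i)"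
      proof (rule integral_dominated_convergence[where w = "\<lambda>_. 1"])
        show "AE t in M i. norm (g m t) \<le> 1" for m
          by (simp add: g_def step_le)
      qed (use g_lim in auto)
      then show "(\<lambda>m. \<integral>t. g m t \<partial>M i) \<longlonglongrightarrow> measure (M i) {..a}"
        by (simp add: space[OF i])
    qed
    show "(\<lambda>m. \<Sum>i<n. c i * (\<integral>t. g m t \<partial>M i)) \<longlonglongrightarrow> 0"
      by (simp add: sum_moments_zero_imp_continuous[OF M moments cont])
  qed
  \<comment> \<open>The zeroth moment is the total mass; the complement step of the induction rests
    on it.\<close>
  have UNIV0: "(\<Sum>i<n. c i * measure (M i) UNIV) = 0"
    using moments[of 0] by (simp add: space)
  have borel: "sigma_sets UNIV (range atMost) = sets (borel :: real measure)"
    by (simp add: borel_eq_atMost)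
  have "Int_stable (range (atMost :: real \<Rightarrow> real set))"
    by (auto simp: Int_stable_def)
  moreover have "range atMost \<subseteq> Pow (UNIV :: real set)"
    by simp
  moreover have "S \<in> sigma_sets UNIV (range atMost)"
    using S by (simp add: borel)
  ultimately show ?thesis
  proof (induction rule: sigma_sets_induct_disjoint)
    case (compl A)
    have "c i * measure (M i) (UNIV - A) = c i * measure (M i) UNIV - c i * measure (M i) A" if "i < n" for i
      using finite_measure.finite_measure_compl[OF fin[OF that]] compl(1)
      by (simp add: space[OF that] sets[OF that] borel right_diff_distrib)
    then show ?case
      using compl(2) UNIV0 by (simp add: sum_subtractf)
  next
    case (union A)
    have "(\<lambda>k. c i * measure (M i) (A k)) sums (c i * measure (M i) (\<Union>k. A k))" if "i < n" for i
      using union(1,2) fin[OF that] sets[OF that]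
      by (intro sums_mult finite_measure.finite_measure_UNION) (auto simp: borel)
    then have "(\<lambda>k. \<Sum>i<n. c i * measure (M i) (A k)) sums (\<Sum>i<n. c i * measure (M i) (\<Union>k. A k))"
      by (intro sums_sum) auto
    then show ?case
      using union(3) by (simp add: sums_iff)
  qed (use atMost in auto)
qed

text \<open>Linear relations between measures are encoded by lists of pairs (coefficient, measure).\<close>

lemma moments_determine:
  assumes M: "\<forall>(c, M)\<in>set l. unit_interval_measure M"
    and moments: "\<And>k. (\<Sum>(c, M)\<leftarrow>l. c * (\<integral>t. t ^ k \<partial>M)) = 0"
    and S: "S \<in> sets borel"
  shows "(\<Sum>(c, M)\<leftarrow>l. c * measure M S) = (0::real)"
proof -
  have *: "(\<Sum>(c, M)\<leftarrow>l. c * F M) = (\<Sum>i<length l. fst (l ! i) * F (snd (l ! i)))" for F :: "real measure \<Rightarrow> real"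
    by (simp add: sum_list_sum_nth atLeast0LessThan case_prod_unfold)
  show ?thesis
    unfolding *
  proof (rule sum_moments_zero_imp_sets)
    show "(\<Sum>i<length l. fst (l ! i) * (\<integral>t. t ^ k \<partial>snd (l ! i))) = 0" for k
      using moments[of k] unfolding * .
  qed (use M S in \<open>auto simp: case_prod_unfold\<close>)
qed

section \<open>The real inner product\<close>

text \<open>The real inner product turns the space into a real Hilbert space, and the complex inner
  product is recovered by \<open>Im (cinner x y) = rinner x (\<i> *\<^sub>C y)\<close>.\<close>

definition rinner :: "'a::complex_hilbert_space \<Rightarrow> 'a \<Rightarrow> real" where
  "rinner x y = Re (cinner x y)"

lemma cinner_add_right: "cinner x (y + z) = cinner x y + cinner x z"
  by (metis cinner_add_left cinner_commute complex_cnj_add)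

lemma cinner_scaleC_right: "cinner x (c *\<^sub>C y) = cnj c * cinner x y"
  by (metis cinner_commute cinner_scaleC_left complex_cnj_mult)

lemma rinner_commute: "rinner x y = rinner y x"
  unfolding rinner_def by (subst cinner_commute) simp

lemma rinner_self: "rinner x x = (norm x)\<^sup>2"
  by (simp add: rinner_def cinner_self)

lemma rinner_add_left: "rinner (x + y) z = rinner x z + rinner y z"
  by (simp add: rinner_def cinner_add_left)

lemma rinner_scaleR_left: "rinner (r *\<^sub>R x) y = r * rinner x y"
  by (simp add: rinner_def cinner_scaleC_left flip: scaleC_of_real)

lemma rinner_add_right: "rinner x (y + z) = rinner x y + rinner x z"
  by (metis rinner_add_left rinner_commute)

lemma rinner_scaleR_right: "rinner x (r *\<^sub>R y) = r * rinner x y"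
  by (metis rinner_scaleR_left rinner_commute)

lemma norm_add_sq: "(norm (x + y))\<^sup>2 = (norm x)\<^sup>2 + 2 * rinner x y + (norm y)\<^sup>2"
  by (simp add: rinner_add_left rinner_add_right rinner_commute[of y x] flip: rinner_self)

lemma norm_diff_scaleR_sq: "(norm (x - t *\<^sub>R y))\<^sup>2 = (norm x)\<^sup>2 - 2 * t * rinner x y + t\<^sup>2 * (norm y)\<^sup>2"
  using norm_add_sq[of x "(- t) *\<^sub>R y"]
  by (simp add: rinner_scaleR_right rinner_scaleR_left power_mult_distrib del: scaleR_minus_left)
    (simp add: power_mult_distrib)

lemma rinner_le_norm: "\<bar>rinner x y\<bar> \<le> norm x * norm y"
proof (cases "y = 0")
  case True
  then show ?thesis using rinner_scaleR_right[of x 0 0] by simp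
next
  case False
  have "0 \<le> (norm (x - (rinner x y / (norm y)\<^sup>2) *\<^sub>R y))\<^sup>2"
    by simp
  also have "\<dots> = (norm x)\<^sup>2 - (rinner x y)\<^sup>2 / (norm y)\<^sup>2"
    unfolding norm_diff_scaleR_sq using False by (simp add: field_simps power2_eq_square)
  finally have "(rinner x y)\<^sup>2 \<le> (norm x * norm y)\<^sup>2"
    using False by (simp add: field_simps power_mult_distrib)
  then show ?thesis
    by (simp add: abs_le_square_iff[symmetric] abs_mult)
qed

interpretation rinner: bounded_bilinear "rinner :: 'a::complex_hilbert_space \<Rightarrow> 'a \<Rightarrow> real"
proof
  show "\<exists>K. \<forall>a b. norm (rinner a b :: real) \<le> norm (a :: 'a) * norm b * K"
    by (intro exI[of _ 1]) (simp add: rinner_le_norm)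
qed (simp_all add: rinner_add_left rinner_add_right rinner_scaleR_left rinner_scaleR_right)

lemma norm_diff_sq: "(norm (x - y))\<^sup>2 = (norm x)\<^sup>2 - 2 * rinner x y + (norm y)\<^sup>2"
  using norm_diff_scaleR_sq[of x 1 y] by simp

lemma rinner_polar: "4 * rinner x y = (norm (x + y))\<^sup>2 - (norm (x - y))\<^sup>2"
  by (simp add: norm_add_sq norm_diff_sq)

lemma rinner_eqI: "(\<And>z. rinner x z = rinner y z) \<Longrightarrow> x = y"
  using rinner_self[of "x - y"] by (simp add: rinner.diff_left rinner.diff_right)

lemma rinner_imag_right: "rinner x (\<i> *\<^sub>C y) = Im (cinner x y)"
  by (simp add: rinner_def cinner_scaleC_right)

lemma rinner_imag_left: "rinner (\<i> *\<^sub>C x) y = - rinner x (\<i> *\<^sub>C y)"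
  by (simp add: rinner_def cinner_scaleC_right cinner_scaleC_left)

lemma cinner_eq_rinner: "cinner x y = Complex (rinner x y) (rinner x (\<i> *\<^sub>C y))"
  by (simp add: complex_eq_iff rinner_imag_right) (simp add: rinner_def)

lemma cinner_diff_left: "cinner (x - y) z = cinner x z - cinner y z"
  by (metis add_diff_cancel_right' cinner_add_left diff_add_cancel)

lemma cinner_zero_left [simp]: "cinner 0 y = 0"
  using cinner_diff_left[of 0 0 y] by simp

lemma cinner_zero_right [simp]: "cinner x 0 = 0"
  by (subst cinner_commute) simp

lemma cinner_sum_left: "cinner (\<Sum>i\<in>I. f i) y = (\<Sum>i\<in>I. cinner (f i) y)"
  by (induction I rule: infinite_finite_induct) (auto simp: cinner_add_left)

lemma norm_scaleC: "norm (c *\<^sub>C x) = cmod c * norm x"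
proof -
  have "complex_of_real ((norm (c *\<^sub>C x))\<^sup>2) = cinner (c *\<^sub>C x) (c *\<^sub>C x)"
    by (simp only: cinner_self)
  also have "\<dots> = c * cnj c * complex_of_real ((norm x)\<^sup>2)"
    unfolding cinner_scaleC_left cinner_scaleC_right by (simp add: cinner_self)
  also have "\<dots> = complex_of_real ((cmod c * norm x)\<^sup>2)"
    by (simp add: complex_mult_cnj cmod_power2 power_mult_distrib)
  finally have "(norm (c *\<^sub>C x))\<^sup>2 = (cmod c * norm x)\<^sup>2"
    by (simp only: of_real_eq_iff)
  then show ?thesis by (simp add: power2_eq_iff_nonneg)
qed

lemma scaleC_eq: "c *\<^sub>C x = Re c *\<^sub>R x + Im c *\<^sub>R (\<i> *\<^sub>C x)"
proof -
  have "c *\<^sub>C x = (complex_of_real (Re c) + complex_of_real (Im c) * \<i>) *\<^sub>C x"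
    by (simp add: complex_eq mult.commute)
  then show ?thesis
    by (simp only: scaleC_add_left scaleC_of_real flip: scaleC_scaleC)
qed

lemma bounded_linear_scaleC: "bounded_linear (\<lambda>x. c *\<^sub>C x :: 'a::complex_hilbert_space)"
proof (rule bounded_linear_intro[where K = "cmod c"])
  show "c *\<^sub>C (r *\<^sub>R x) = r *\<^sub>R (c *\<^sub>C x)" for r and x :: 'a
    by (simp add: scaleC_scaleC mult.commute flip: scaleC_of_real)
qed (simp_all add: scaleC_add_right norm_scaleC mult.commute)

section \<open>Subspaces, orthogonal projection and Riesz representation\<close>

lemma real_subspaceI: "complex_vector.subspace S \<Longrightarrow> subspace S"
  unfolding complex_vector.subspace_def subspace_def scaleC_of_real[symmetric] by blast

lemma subspace_closure:
  fixes S :: "'a::real_normed_vector set"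
  assumes "subspace S"
  shows "subspace (closure S)"
proof (rule subspaceI)
  show "0 \<in> closure S"
    using subspace_0[OF assms] closure_subset by blast
  show "x + y \<in> closure S" if "x \<in> closure S" "y \<in> closure S" for x y
    using that subspace_add[OF assms] unfolding closure_sequential
    by (elim exE conjE) (rule exI, rule conjI[rotated], erule (1) tendsto_add, blast)
  show "c *\<^sub>R x \<in> closure S" if "x \<in> closure S" for c x
    using that subspace_scale[OF assms] unfolding closure_sequential
    by (elim exE conjE) (rule exI, rule conjI[rotated], erule tendsto_scaleR[OF tendsto_const], blast)
qed

text \<open>The minimizing sequence of the distance is Cauchy by the parallelogram identity.\<close>

lemma projection_exists:
  fixes M :: "'a::complex_hilbert_space set"
  assumes M: "subspace M" "closed M"
  obtains u where "u \<in> M" "\<And>m. m \<in> M \<Longrightarrow> rinner (x - u) m = 0"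
proof -
  define D where "D = (\<lambda>m. (norm (x - m))\<^sup>2) ` M"
  define d where "d = Inf D"
  have "bdd_below D" by (auto simp: D_def intro: bdd_belowI[of _ 0])
  moreover have ne: "D \<noteq> {}" using subspace_0[OF M(1)] by (auto simp: D_def)
  ultimately have d_le: "d \<le> (norm (x - m))\<^sup>2" if "m \<in> M" for m
    using that unfolding d_def by (auto simp: D_def intro!: cInf_lower)
  have "\<exists>m\<in>M. (norm (x - m))\<^sup>2 < d + 1 / real (Suc n)" for n
    using cInf_lessD[OF ne, of "d + 1 / real (Suc n)"] by (auto simp: d_def D_def)
  then obtain m where m: "\<And>n. m n \<in> M" and mn: "\<And>n. (norm (x - m n))\<^sup>2 < d + 1 / real (Suc n)"
    by metis
  have par: "(norm (m n - m k))\<^sup>2 \<le> 2 / real (Suc n) + 2 / real (Suc k)" for n k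
  proof -
    have "(norm ((x - m k) - (x - m n)))\<^sup>2 + (norm ((x - m k) + (x - m n)))\<^sup>2 =
        2 * (norm (x - m k))\<^sup>2 + 2 * (norm (x - m n))\<^sup>2"
      unfolding norm_add_sq norm_diff_sq by simp
    moreover have "(x - m k) + (x - m n) = 2 *\<^sub>R (x - (1/2) *\<^sub>R (m k + m n))"
      by (simp add: algebra_simps scaleR_2)
    moreover have "d \<le> (norm (x - (1/2) *\<^sub>R (m k + m n)))\<^sup>2"
      by (intro d_le subspace_scale subspace_add M m)
    ultimately show ?thesis
      using mn[of n] mn[of k] by (simp add: power_mult_distrib norm_minus_commute)
  qed
  have "Cauchy m"
  proof (rule metric_CauchyI)
    fix e :: real assume e: "e > 0"
    obtain n0 where n0: "4 / e\<^sup>2 < real n0" using reals_Archimedean2 by blast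
    have "dist (m n) (m k) < e" if "n \<ge> n0" "k \<ge> n0" for n k
    proof -
      have *: "2 / real (Suc j) < e\<^sup>2 / 2" if "j \<ge> n0" for j
      proof -
        have "4 / e\<^sup>2 < real (Suc j)" using n0 that by linarith
        then show ?thesis using e by (simp add: field_simps)
      qed
      have "(norm (m n - m k))\<^sup>2 < e\<^sup>2"
        using par[of n k] *[OF that(1)] *[OF that(2)] by linarith
      then show ?thesis
        using e by (simp add: dist_norm power2_less_imp_less)
    qed
    then show "\<exists>M. \<forall>n\<ge>M. \<forall>k\<ge>M. dist (m n) (m k) < e" by blast
  qed
  then obtain u where u: "m \<longlonglongrightarrow> u"
    using Cauchy_convergent convergent_def by blast
  have uM: "u \<in> M" using closed_sequentially[OF M(2) m u] .
  have "(\<lambda>n. (norm (x - m n))\<^sup>2) \<longlonglongrightarrow> (norm (x - u))\<^sup>2"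
    by (intro tendsto_intros u)
  moreover have "(\<lambda>n. d + 1 / real (Suc n)) \<longlonglongrightarrow> d + 0"
    by (intro tendsto_intros filterlim_compose[OF lim_1_over_n filterlim_Suc])
  ultimately have "(norm (x - u))\<^sup>2 \<le> d + 0"
    by (rule LIMSEQ_le) (use mn less_imp_le in blast)
  then have min: "(norm (x - u))\<^sup>2 \<le> (norm (x - m))\<^sup>2" if "m \<in> M" for m
    using d_le[OF that] by linarith
  have "rinner (x - u) v = 0" if v: "v \<in> M" for v
  proof (cases "v = 0")
    case False
    \<comment> \<open>This \<open>t\<close> minimizes the distance from x to u + t v, so a nonzero
      inner product would beat the minimizer \<open>u\<close>.\<close>
    define t where "t = rinner (x - u) v / (norm v)\<^sup>2"
    have "u + t *\<^sub>R v \<in> M" by (intro subspace_add subspace_scale M uM v)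
    from min[OF this] have "(norm (x - u))\<^sup>2 \<le> (norm ((x - u) - t *\<^sub>R v))\<^sup>2"
      by (simp add: algebra_simps)
    also have "\<dots> = (norm (x - u))\<^sup>2 - (rinner (x - u) v)\<^sup>2 / (norm v)\<^sup>2"
      unfolding norm_diff_scaleR_sq t_def using False by (simp add: field_simps power2_eq_square)
    finally show ?thesis using False by (simp add: divide_le_0_iff)
  qed (simp add: rinner.zero_right)
  with uM show thesis by (rule that)
qed

text \<open>A vector \<open>w\<close> orthogonal to the kernel represents \<open>f\<close> up to a
  scalar, since \<open>y - (f y / f w) *\<^sub>R w\<close> lies in the kernel for every
  \<open>y\<close>.\<close>

lemma riesz_representation:
  fixes f :: "'a::complex_hilbert_space \<Rightarrow> real"
  assumes "bounded_linear f"
  obtains v where "\<And>x. f x = rinner v x"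
proof (cases "\<forall>x. f x = 0")
  case True
  then show thesis using that[of 0] by (simp add: rinner.zero_left)
next
  case False
  interpret f: bounded_linear f by fact
  obtain x where x: "f x \<noteq> 0" using False by blast
  define M where "M = {x. f x = 0}"
  have sub: "subspace M"
    by (auto simp: M_def subspace_def f.zero f.add f.scaleR)
  have "closed M"
    unfolding M_def by (intro closed_Collect_eq continuous_intros f.continuous_on)
  then obtain u where u: "u \<in> M" "\<And>m. m \<in> M \<Longrightarrow> rinner (x - u) m = 0"
    using projection_exists[OF sub] by blast
  define w where "w = x - u"
  have fw: "f w \<noteq> 0" using x u(1) by (simp add: w_def f.diff M_def)
  have nw: "norm w \<noteq> 0" using fw f.zero by auto
  have "f y = rinner ((f w / (norm w)\<^sup>2) *\<^sub>R w) y" for y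
  proof -
    have "y - (f y / f w) *\<^sub>R w \<in> M"
      using fw by (simp add: M_def f.diff f.scaleR)
    from u(2)[OF this] have "rinner w y = f y / f w * (norm w)\<^sup>2"
      by (simp add: rinner.diff_right rinner.scaleR_right rinner_self flip: w_def)
    then show ?thesis
      using fw nw by (simp add: rinner.scaleR_left)
  qed
  then show thesis by (rule that)
qed

section \<open>Infinite dimension and orthogonality\<close>

lemma cinner_span_eq_0:
  assumes "y \<in> complex_vector.span B" "\<And>b. b \<in> B \<Longrightarrow> cinner x b = 0"
  shows "cinner x y = 0"
  using assms(1)
  by (induction rule: complex_vector.span_induct_alt)
    (simp_all add: cinner_add_right cinner_scaleC_right assms(2))

lemma infinite_dimensional_mono: "infinite_dimensional S \<Longrightarrow> S \<subseteq> T \<Longrightarrow> infinite_dimensional T"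
  unfolding infinite_dimensional_def by blast

text \<open>Orthogonality to one more vector cuts out the kernel of a linear functional and so costs
  at most one dimension: any \<open>y\<close> outside the kernel spans the rest.\<close>

lemma infinite_dimensional_Int_orthogonal:
  assumes "finite G" "complex_vector.subspace S" "infinite_dimensional S"
  shows "infinite_dimensional {x \<in> S. \<forall>g\<in>G. cinner x g = 0}"
  using assms(1)
proof (induction G rule: finite_induct)
  case empty
  then show ?case using assms by simp
next
  case (insert g G)
  define W where "W = {x \<in> S. \<forall>g\<in>G. cinner x g = 0}"
  have W: "x - c *\<^sub>C y \<in> W" if "x \<in> W" "y \<in> W" for x y c
    using that assms(2) by (auto simp: W_def cinner_diff_left cinner_scaleC_left
        intro: complex_vector.subspace_diff complex_vector.subspace_scale)
  have "\<not> (\<exists>B. finite B \<and> {x \<in> W. cinner x g = 0} \<subseteq> complex_vector.span B)"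
  proof (rule notI, elim exE conjE)
    fix B assume B: "finite B" "{x \<in> W. cinner x g = 0} \<subseteq> complex_vector.span B"
    have "\<exists>B. finite B \<and> W \<subseteq> complex_vector.span B"
    proof (cases "\<exists>y\<in>W. cinner y g \<noteq> 0")
      case True
      then obtain y where y: "y \<in> W" "cinner y g \<noteq> 0" by blast
      have "x \<in> complex_vector.span (insert y B)" if "x \<in> W" for x
      proof -
        have "x - (cinner x g / cinner y g) *\<^sub>C y \<in> complex_vector.span B"
          using B(2) W[OF that y(1)] y(2) by (auto simp: cinner_diff_left cinner_scaleC_left)
        then show ?thesis
          unfolding complex_vector.span_insert by auto
      qed
      then show ?thesis using B(1) by (intro exI[of _ "insert y B"]) auto
    next
      case False
      then show ?thesis using B by blast
    qed
    then show False
      using insert.IH by (simp add: infinite_dimensional_def W_def)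
  qed
  moreover have "{x \<in> S. \<forall>g\<in>insert g G. cinner x g = 0} = {x \<in> W. cinner x g = 0}"
    by (auto simp: W_def)
  ultimately show ?case
    by (simp add: infinite_dimensional_def)
qed

lemma infinite_dimensional_obtain_orthogonal:
  assumes "finite G" "complex_vector.subspace S" "infinite_dimensional S"
  obtains x where "x \<in> S" "x \<noteq> 0" "\<And>g. g \<in> G \<Longrightarrow> cinner x g = 0"
proof -
  have "\<not> {x \<in> S. \<forall>g\<in>G. cinner x g = 0} \<subseteq> complex_vector.span {}"
    using infinite_dimensional_Int_orthogonal[OF assms] unfolding infinite_dimensional_def by blast
  then obtain x where "x \<in> S" "x \<noteq> 0" "\<forall>g\<in>G. cinner x g = 0"
    unfolding complex_vector.span_empty by blast
  then show thesis using that by blast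
qed

text \<open>Nonzero orthogonal vectors are independent, so no finite set can span families of every
  size. The families for different \<open>n\<close> may be unrelated, and the free index type allows
  points of the spectrum as indices.\<close>

lemma infinite_dimensional_of_orthogonal:
  fixes S :: "'a::complex_hilbert_space set"
  assumes "\<And>n. \<exists>(F :: 'b set) e. finite F \<and> card F = n \<and>
     (\<forall>i\<in>F. e i \<in> S \<and> e i \<noteq> 0) \<and> (\<forall>i\<in>F. \<forall>j\<in>F. i \<noteq> j \<longrightarrow> cinner (e i) (e j) = 0)"
  shows "infinite_dimensional S"
  unfolding infinite_dimensional_def
proof (rule notI, elim exE conjE)
  fix B assume B: "finite B" "S \<subseteq> complex_vector.span B"
  obtain F :: "'b set" and e where *: "finite F \<and> card F = Suc (card B) \<and>
     (\<forall>i\<in>F. e i \<in> S \<and> e i \<noteq> 0) \<and> (\<forall>i\<in>F. \<forall>j\<in>F. i \<noteq> j \<longrightarrow> cinner (e i) (e j) = 0)"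
    using assms[of "Suc (card B)"] by (elim exE)
  have F: "finite F" "card F = Suc (card B)"
    and e: "\<And>i. i \<in> F \<Longrightarrow> e i \<in> S" "\<And>i. i \<in> F \<Longrightarrow> e i \<noteq> 0"
    and orth: "\<And>i j. i \<in> F \<Longrightarrow> j \<in> F \<Longrightarrow> i \<noteq> j \<Longrightarrow> cinner (e i) (e j) = 0"
    using * by simp_all
  have nz: "cinner (e i) (e i) \<noteq> 0" if "i \<in> F" for i
    using e(2)[OF that] by (simp add: cinner_self)
  have inj: "inj_on e F"
    by (rule inj_onI) (metis nz orth)
  have "complex_vector.independent (e ` F)"
  proof (subst complex_vector.dependent_finite)
    show "\<not> (\<exists>u. (\<exists>v\<in>e ` F. u v \<noteq> 0) \<and> (\<Sum>v\<in>e ` F. u v *\<^sub>C v) = 0)"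
    proof (rule notI, elim exE conjE bexE)
      fix u v assume v: "v \<in> e ` F" "u v \<noteq> 0" and s: "(\<Sum>v\<in>e ` F. u v *\<^sub>C v) = 0"
      obtain i where i: "i \<in> F" "v = e i" using v by blast
      have "0 = cinner (\<Sum>v\<in>e ` F. u v *\<^sub>C v) (e i)" by (simp add: s)
      also have "\<dots> = (\<Sum>j\<in>F. u (e j) * cinner (e j) (e i))"
        by (simp add: sum.reindex[OF inj] cinner_sum_left cinner_scaleC_left)
      also have "\<dots> = (\<Sum>j\<in>F. if j = i then u (e i) * cinner (e i) (e i) else 0)"
        by (intro sum.cong) (auto simp: orth i)
      also have "\<dots> = u (e i) * cinner (e i) (e i)"
        using F i by simp
      finally show False using nz[OF i(1)] v i by simp
    qed
  qed (use F in simp)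
  moreover have "e ` F \<subseteq> complex_vector.span B" using e B by blast
  ultimately have "card (e ` F) \<le> card B"
    using complex_vector.independent_span_bound[OF B(1)] by blast
  then show False using F by (simp add: card_image[OF inj])
qed

section \<open>The spectral theorem\<close>

text \<open>Turns a factor under the integral into a new measure to which uniqueness of moments
  applies; used for powers of t (applying powers of the operator) and for indicators (applying a
  projection).\<close>

lemma density_unit_interval_measure:
  fixes g :: "real \<Rightarrow> real"
  assumes M: "unit_interval_measure M" and g [measurable]: "g \<in> borel_measurable borel"
    and g01: "\<And>t. t \<in> {0..1} \<Longrightarrow> 0 \<le> g t \<and> g t \<le> 1"
  defines "N \<equiv> density M (\<lambda>t. ennreal (g t))"
  shows "unit_interval_measure N"
    and "f \<in> borel_measurable borel \<Longrightarrow> (\<integral>t. f t \<partial>N) = (\<integral>t. g t * f t \<partial>M)"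
    and "S \<in> sets borel \<Longrightarrow> measure N S = (\<integral>t. g t * indicator S t \<partial>M)"
proof -
  interpret finite_measure M using M by (simp add: unit_interval_measure_def)
  have sets: "sets M = sets borel" and AE: "AE t in M. t \<in> {0..1}"
    using M by (auto simp: unit_interval_measure_def)
  note sets[measurable_cong]
  have space: "space M = UNIV" using sets_eq_imp_space_eq[OF sets] by simp
  show int: "(\<integral>t. f t \<partial>N) = (\<integral>t. g t * f t \<partial>M)" if [measurable]: "f \<in> borel_measurable borel" for f :: "real \<Rightarrow> real"
  proof -
    have "AE t in M. 0 \<le> g t" using AE by eventually_elim (use g01 in auto)
    then show ?thesis unfolding N_def by (subst integral_density) auto
  qed
  have "emeasure N UNIV = (\<integral>\<^sup>+t. ennreal (g t) \<partial>M)"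
    unfolding N_def by (subst emeasure_density) (auto simp: space[symmetric])
  also have "\<dots> \<le> (\<integral>\<^sup>+t. 1 \<partial>M)"
    by (rule nn_integral_mono_AE) (use AE in \<open>eventually_elim, use g01 in \<open>auto simp: ennreal_le_1\<close>\<close>)
  also have "\<dots> < \<top>" using emeasure_finite by (simp add: less_top[symmetric])
  finally have fin: "finite_measure N"
    by (intro finite_measureI) (simp add: N_def space less_top)
  have "AE t in N. t \<in> {0..1}"
    unfolding N_def by (subst AE_density) (use AE in \<open>auto elim: AE_mp\<close>)
  moreover have "sets N = sets borel" by (simp add: N_def sets)
  ultimately show "unit_interval_measure N"
    using fin by (simp only: unit_interval_measure_def simp_thms)
  show "measure N S = (\<integral>t. g t * indicator S t \<partial>M)" if [measurable]: "S \<in> sets borel"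
  proof -
    have "space N = UNIV" by (simp add: N_def space)
    then have "measure N S = (\<integral>t. indicator S t \<partial>N)" by simp
    also have "\<dots> = (\<integral>t. g t * indicator S t \<partial>M)" by (rule int) simp
    finally show ?thesis .
  qed
qed

lemma bounded_selfadjointD:
  assumes "bounded_selfadjoint T"
  shows "bounded_linear T" "T (c *\<^sub>C x) = c *\<^sub>C T x" "cinner (T x) y = cinner x (T y)" "rinner (T x) y = rinner x (T y)"
  using assms by (auto simp: bounded_selfadjoint_def bounded_clinear_def rinner_def)

text \<open>Real linearity and commutation with \<i> give complex linearity, and then real symmetry
  also controls the imaginary part of the inner product.\<close>

lemma bounded_selfadjointI:
  assumes "bounded_linear T" "\<And>x. T (\<i> *\<^sub>C x) = \<i> *\<^sub>C T x" "\<And>x y. rinner (T x) y = rinner x (T y)"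
  shows "bounded_selfadjoint T"
proof -
  interpret bounded_linear T by fact
  have "T (c *\<^sub>C x) = c *\<^sub>C T x" for c x
    by (subst (1 2) scaleC_eq) (simp add: add scaleR assms(2))
  moreover have "cinner (T x) y = cinner x (T y)" for x y
    by (simp add: cinner_eq_rinner assms(3)) (simp add: assms(2))
  ultimately show ?thesis
    using assms(1) by (simp add: bounded_selfadjoint_def bounded_clinear_def)
qed

lemma cinner_selfadjoint_real:
  assumes "bounded_selfadjoint T"
  shows "cinner (T x) x = complex_of_real (rinner (T x) x)"
proof -
  have "cinner (T x) x = cnj (cinner (T x) x)"
    using bounded_selfadjointD(3)[OF assms, of x x] cinner_commute[of x "T x"] by simp
  then have "Im (cinner (T x) x) = 0"
    by (metis Reals_cnj_iff complex_is_Real_iff)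
  then show ?thesis by (simp add: complex_eq_iff rinner_def)
qed

section \<open>Spectral projections of an operator between 0 and 1\<close>

locale unit_selfadjoint =
  fixes T :: "'a::complex_hilbert_space \<Rightarrow> 'a"
  assumes selfadj: "bounded_selfadjoint T"
    and nonneg: "\<And>x. 0 \<le> rinner (T x) x" and le: "\<And>x. rinner (T x) x \<le> (norm x)\<^sup>2"
begin

sublocale T: bounded_linear T
  by (rule bounded_selfadjointD(1)[OF selfadj])

lemma sym: "rinner (T x) y = rinner x (T y)"
  by (rule bounded_selfadjointD(4)[OF selfadj])

lemma bounded_linear_pow: "bounded_linear (T ^^ k)"
  by (induction k) (auto simp: id_def comp_def bounded_linear_ident intro: T.bounded_linear bounded_linear_compose)

sublocale pow: bounded_linear "T ^^ k" for k
  by (rule bounded_linear_pow)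

lemma pow_scaleC: "(T ^^ k) (c *\<^sub>C x) = c *\<^sub>C (T ^^ k) x"
  by (induction k) (simp_all add: bounded_selfadjointD(2)[OF selfadj])

lemma pow_sym: "rinner ((T ^^ k) x) y = rinner x ((T ^^ k) y)"
  by (induction k arbitrary: x y) (simp_all add: sym funpow_swap1)

text \<open>The operator T^k (1 - T)^m; its quadratic form supplies the array \<open>L\<close> of
  the moment problem.\<close>

definition mixed :: "nat \<Rightarrow> nat \<Rightarrow> 'a \<Rightarrow> 'a" where
  "mixed k m x = (T ^^ k) (((\<lambda>x. x - T x) ^^ m) x)"

lemma mixed_simps:
  "mixed 0 0 x = x" "mixed (Suc k) m x = T (mixed k m x)"
  "mixed k (Suc m) x = mixed k m x - T (mixed k m x)"
  "mixed k m (T x) = T (mixed k m x)" "mixed k m (x - T x) = mixed k m x - T (mixed k m x)"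
proof -
  have *: "((\<lambda>x. x - T x) ^^ m) (T x) = T (((\<lambda>x. x - T x) ^^ m) x)" for x
    by (induction m) (simp_all add: T.diff)
  show "mixed k m (T x) = T (mixed k m x)"
    by (simp add: mixed_def * funpow_swap1)
  show "mixed k (Suc m) x = mixed k m x - T (mixed k m x)"
    by (simp add: mixed_def pow.diff funpow_swap1)
  show "mixed k m (x - T x) = mixed k m x - T (mixed k m x)"
    by (simp add: mixed_def funpow_swap1[of "\<lambda>x. x - T x", symmetric] pow.diff) (simp add: funpow_swap1)
qed (simp_all add: mixed_def)

text \<open>Splitting off squares \<open>\<langle>T y, T x\<rangle>\<close> and \<open>\<langle>(1 - T) y, (1 - T) x\<rangle>\<close> reduces to exponents at most 1, and
  \<open>T (1 - T) = T (1 - T)\<^sup>2 + T\<^sup>2 (1 - T)\<close>.\<close>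

lemma mixed_nonneg: "0 \<le> rinner (mixed k m x) x"
proof (induction "k + m" arbitrary: k m x rule: less_induct)
  case less
  consider k' where "k = Suc (Suc k')" | m' where "m = Suc (Suc m')" | "k \<in> {0, 1}" "m \<in> {0, 1}"
    by (metis One_nat_def insert_iff old.nat.exhaust)
  then show ?case
  proof cases
    case 1
    have "rinner (mixed k m x) x = rinner (mixed k' m (T x)) (T x)"
      by (simp add: 1 mixed_simps sym)
    then show ?thesis using less[of k' m] 1 by simp
  next
    case 2
    have "rinner (mixed k m x) x = rinner (mixed k m' (x - T x)) (x - T x)"
      by (simp add: 2 mixed_simps(3,5) sym rinner.diff_left rinner.diff_right T.diff)
    then show ?thesis using less[of k m'] 2 by simp
  next
    case 3
    have "rinner (T (x - T x)) x = rinner (T (x - T x)) (x - T x) + (rinner (T x) (T x) - rinner (T (T x)) (T x))"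
      by (simp add: T.diff rinner.diff_left rinner.diff_right sym)
    also have "\<dots> \<ge> 0"
      using nonneg[of "x - T x"] le[of "T x"] by (simp add: rinner_self)
    finally show ?thesis
      using 3 nonneg[of x] le[of x] by (auto simp: mixed_simps rinner.diff_left rinner_self T.diff)
  qed
qed

text \<open>The choice is harmless: by \<open>moments_determine\<close> all candidates agree on
  Borel sets.\<close>

definition spectral_distr :: "'a \<Rightarrow> real measure" where
  "spectral_distr x = (SOME M. unit_interval_measure M \<and> (\<forall>j. (\<integral>t. t ^ j \<partial>M) = rinner ((T ^^ j) x) x))"

lemma spectral_distr:
  "unit_interval_measure (spectral_distr x)" "(\<integral>t. t ^ j \<partial>spectral_distr x) = rinner ((T ^^ j) x) x"
proof -
  obtain M where "unit_interval_measure M" "\<And>j. (\<integral>t. t ^ j \<partial>M) = rinner (mixed j 0 x) x"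
    by (rule hausdorff_moment[of "\<lambda>k m. rinner (mixed k m x) x"])
      (auto simp: mixed_simps rinner.diff_left mixed_nonneg)
  then have "\<exists>M. unit_interval_measure M \<and> (\<forall>j. (\<integral>t. t ^ j \<partial>M) = rinner ((T ^^ j) x) x)"
    by (auto simp: mixed_def)
  from someI_ex[OF this]
  show "unit_interval_measure (spectral_distr x)" "(\<integral>t. t ^ j \<partial>spectral_distr x) = rinner ((T ^^ j) x) x"
    unfolding spectral_distr_def by blast+
qed

sublocale spectral_distr: finite_measure "spectral_distr x" for x
  using spectral_distr(1) by (simp add: unit_interval_measure_def)

lemma sets_spectral_distr [simp, measurable_cong]: "sets (spectral_distr x) = sets borel"
  using spectral_distr(1) by (simp add: unit_interval_measure_def)

lemma space_spectral_distr [simp]: "space (spectral_distr x) = UNIV"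
  using sets_eq_imp_space_eq[OF sets_spectral_distr] by simp

lemma measure_spectral_distr_UNIV: "measure (spectral_distr x) UNIV = (norm x)\<^sup>2"
  using spectral_distr(2)[of x 0] by (simp add: rinner_self)

lemma measure_spectral_distr_le: "measure (spectral_distr x) S \<le> (norm x)\<^sup>2"
  using spectral_distr.bounded_measure[of x S] by (simp add: measure_spectral_distr_UNIV)

text \<open>Real polarization of the measures at \<open>S\<close>. It becomes the inner product of
  the projected \<open>x\<close> with \<open>y\<close>.\<close>

definition form :: "real set \<Rightarrow> 'a \<Rightarrow> 'a \<Rightarrow> real" where
  "form S x y = (measure (spectral_distr (x + y)) S - measure (spectral_distr (x - y)) S) / 4"

text \<open>Polarization replaces each triple (c, x, y) by two measures with weights c / 4 and - c /
  4, whose moments combine to the inner products with powers of \<open>T\<close>. A relation valid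
  for all powers therefore passes to Borel sets; \<open>l'\<close> admits further measures into the
  relation.\<close>

lemma form_relation:
  assumes N: "\<forall>(c, N)\<in>set l'. unit_interval_measure N"
    and moments: "\<And>k. (\<Sum>(c, x, y)\<leftarrow>l. c * rinner ((T ^^ k) x) y) + (\<Sum>(c, N)\<leftarrow>l'. c * (\<integral>t. t ^ k \<partial>N)) = 0"
    and S: "S \<in> sets borel"
  shows "(\<Sum>(c, x, y)\<leftarrow>l. c * form S x y) + (\<Sum>(c, N)\<leftarrow>l'. c * measure N S) = 0"
proof -
  define m where "m = concat (map (\<lambda>(c, x, y). [(c / 4, spectral_distr (x + y)), (- c / 4, spectral_distr (x - y))]) l)"
  have m_sum: "(\<Sum>(c, N)\<leftarrow>m. c * F N) = (\<Sum>(c, x, y)\<leftarrow>l. c * ((F (spectral_distr (x + y)) - F (spectral_distr (x - y))) / 4))"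
    for F :: "real measure \<Rightarrow> real"
    unfolding m_def by (induction l) (auto simp: algebra_simps diff_divide_distrib)
  have polar: "((\<integral>t. t ^ k \<partial>spectral_distr (x + y)) - (\<integral>t. t ^ k \<partial>spectral_distr (x - y))) / 4 = rinner ((T ^^ k) x) y" for k x y
  proof -
    have "rinner ((T ^^ k) y) x = rinner ((T ^^ k) x) y"
      by (metis pow_sym rinner_commute)
    then show ?thesis
      by (simp add: spectral_distr(2) pow.add pow.diff rinner_add_left rinner_add_right rinner.diff_left rinner.diff_right)
  qed
  have "(\<Sum>(c, N)\<leftarrow>m @ l'. c * measure N S) = 0"
  proof (rule moments_determine)
    show "\<forall>(c, N)\<in>set (m @ l'). unit_interval_measure N"
      using N by (auto simp: m_def spectral_distr(1))
    show "(\<Sum>(c, N)\<leftarrow>m @ l'. c * (\<integral>t. t ^ k \<partial>N)) = 0" for k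
      using moments[of k] by (simp add: m_sum polar)
  qed (rule S)
  then show ?thesis
    by (simp add: m_sum form_def)
qed

context
  fixes S :: "real set" assumes S: "S \<in> sets borel"
begin

text \<open>In this and the following identities the list encodes the claim itself, whose analogue
  for powers of \<open>T\<close> is elementary.\<close>

lemma form_add_left: "form S (x + x') y = form S x y + form S x' y"
  using form_relation[of "[]" "[(1, x + x', y), (-1, x, y), (-1, x', y)]", OF _ _ S]
  by (simp add: pow.add rinner_add_left)

lemma form_scaleR_left: "form S (r *\<^sub>R x) y = r * form S x y"
  using form_relation[of "[]" "[(1, r *\<^sub>R x, y), (-r, x, y)]", OF _ _ S]
  by (simp add: pow.scaleR rinner_scaleR_left)

lemma form_commute: "form S x y = form S y x"
proof -
  have "rinner ((T ^^ k) y) x = rinner ((T ^^ k) x) y" for k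
    by (metis pow_sym rinner_commute)
  then show ?thesis
    using form_relation[of "[]" "[(1, x, y), (-1, y, x)]", OF _ _ S] by simp
qed

lemma form_imag: "form S (\<i> *\<^sub>C x) (\<i> *\<^sub>C y) = form S x y"
  using form_relation[of "[]" "[(1, \<i> *\<^sub>C x, \<i> *\<^sub>C y), (-1, x, y)]", OF _ _ S]
  by (simp add: pow_scaleC rinner_imag_left scaleC_scaleC rinner.minus_right)

lemma form_T: "form S (T x) y = form S x (T y)"
  using form_relation[of "[]" "[(1, T x, y), (-1, x, T y)]", OF _ _ S]
  by (simp add: funpow_swap1[symmetric] sym)

lemma form_self: "form S x x = measure (spectral_distr x) S"
  using form_relation[of "[(-1, spectral_distr x)]" "[(1, x, x)]", OF _ _ S]
  by (simp add: spectral_distr)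

text \<open>Riesz representation needs only some bound. On unit vectors both polarized measures are
  at most (norm x + 1)^2, and homogeneity extends the bound.\<close>

lemma bounded_linear_form: "bounded_linear (form S x)"
proof (rule bounded_linear_intro[where K = "(norm x + 1)\<^sup>2"])
  show "form S x (y + z) = form S x y + form S x z" for y z
    by (metis form_add_left form_commute)
  show scale: "form S x (r *\<^sub>R y) = r *\<^sub>R form S x y" for r y
    by (metis form_scaleR_left form_commute real_scaleR_def)
  have unit: "\<bar>form S x y\<bar> \<le> (norm x + 1)\<^sup>2" if "norm y = 1" for y
  proof -
    have "(norm (x + y))\<^sup>2 \<le> (norm x + 1)\<^sup>2" "(norm (x - y))\<^sup>2 \<le> (norm x + 1)\<^sup>2"
      using norm_triangle_ineq[of x y] norm_triangle_ineq4[of x y] that by (auto intro!: power_mono)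
    moreover have "\<bar>measure (spectral_distr (x + y)) S - measure (spectral_distr (x - y)) S\<bar> \<le> max ((norm (x + y))\<^sup>2) ((norm (x - y))\<^sup>2)"
      using measure_spectral_distr_le[of "x + y" S] measure_spectral_distr_le[of "x - y" S]
        measure_nonneg[of "spectral_distr (x + y)" S] measure_nonneg[of "spectral_distr (x - y)" S] by linarith
    ultimately have "\<bar>measure (spectral_distr (x + y)) S - measure (spectral_distr (x - y)) S\<bar> \<le> (norm x + 1)\<^sup>2"
      by linarith
    then show ?thesis by (simp add: form_def)
  qed
  show "norm (form S x y) \<le> norm y * (norm x + 1)\<^sup>2" for y
  proof (cases "y = 0")
    case True
    then show ?thesis using scale[of 0 0] by simp
  next
    case False
    then have "form S x y = norm y * form S x ((1 / norm y) *\<^sub>R y)"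
      by (simp add: scale)
    moreover have "\<bar>form S x ((1 / norm y) *\<^sub>R y)\<bar> \<le> (norm x + 1)\<^sup>2"
      by (rule unit) (use False in simp)
    ultimately show ?thesis by (simp add: abs_mult mult_left_mono)
  qed
qed

end

definition proj :: "real set \<Rightarrow> 'a \<Rightarrow> 'a" where
  "proj S x = (SOME v. \<forall>y. form S x y = rinner v y)"

lemma rinner_proj:
  assumes "S \<in> sets borel"
  shows "rinner (proj S x) y = form S x y"
proof -
  obtain v where "\<And>y. form S x y = rinner v y"
    using riesz_representation[OF bounded_linear_form[OF assms, of x]] by blast
  then have "\<exists>v. \<forall>y. form S x y = rinner v y" by blast
  then have "\<forall>y. form S x y = rinner (proj S x) y"
    unfolding proj_def by (rule someI_ex)
  then show ?thesis by metis
qed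

lemma proj_pow: "S \<in> sets borel \<Longrightarrow> proj S ((T ^^ k) x) = (T ^^ k) (proj S x)"
proof (induction k)
  case (Suc k)
  have "proj S (T x) = T (proj S x)" for x
    by (rule rinner_eqI) (simp add: sym rinner_proj[OF Suc.prems] form_T[OF Suc.prems])
  then show ?case using Suc by simp
qed simp

text \<open>Weighting the measure of z by t^k shifts its moments by k, which corresponds to applying
  T^k. The factor 4 clears the denominator of the polarization.\<close>

lemma form_pow:
  assumes S: "S \<in> sets borel"
  shows "4 * form S ((T ^^ k) x) y =
    (\<integral>t. indicator S t * t ^ k \<partial>spectral_distr (x + y)) - (\<integral>t. indicator S t * t ^ k \<partial>spectral_distr (x - y))"
proof -
  define D where "D z = density (spectral_distr z) (\<lambda>t. ennreal (t ^ k))" for z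
  note D_props = density_unit_interval_measure[OF spectral_distr(1), of "\<lambda>t. t ^ k", folded D_def]
  have D: "unit_interval_measure (D z)"
      "f \<in> borel_measurable borel \<Longrightarrow> (\<integral>t. f t \<partial>D z) = (\<integral>t. t ^ k * f t \<partial>spectral_distr z)"
      "measure (D z) S = (\<integral>t. t ^ k * indicator S t \<partial>spectral_distr z)" for z f
    by (rule D_props; use S in \<open>auto simp: power_le_one\<close>)+
  have mom: "(\<integral>t. t ^ j \<partial>D z) = rinner ((T ^^ j) ((T ^^ k) z)) z" for j z
    by (simp add: D(2) flip: power_add) (simp add: spectral_distr(2) funpow_add add.commute)
  have comm: "rinner ((T ^^ j) ((T ^^ k) y)) x = rinner ((T ^^ j) ((T ^^ k) x)) y" for j
    by (metis pow_sym rinner_commute funpow_add comp_apply add.commute)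
  have "4 * form S ((T ^^ k) x) y - measure (D (x + y)) S + measure (D (x - y)) S = 0"
    using form_relation[of "[(-1, D (x + y)), (1, D (x - y))]" "[(4, (T ^^ k) x, y)]", OF _ _ S]
    by (simp add: D(1) mom pow.add pow.diff rinner_add_left rinner_add_right rinner.diff_left rinner.diff_right comm)
  then show ?thesis
    by (simp add: D(3) mult.commute)
qed

text \<open>Since \<open>proj S\<close> commutes with powers of \<open>T\<close>,
  \<open>form_pow\<close> shows that the form of T^k at \<open>proj S x\<close> is the polarized
  k-th moment of the measures restricted to \<open>S\<close>. By uniqueness the same holds with the
  Borel set \<open>S'\<close> in place of T^k, and restriction to \<open>S\<close> turns
  \<open>S'\<close> into the intersection.\<close>

lemma proj_proj:
  assumes S: "S \<in> sets borel" and S': "S' \<in> sets borel"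
  shows "proj S' (proj S x) = proj (S' \<inter> S) x"
proof (rule rinner_eqI)
  fix y
  define D where "D z = density (spectral_distr z) (\<lambda>t. ennreal (indicator S t))" for z
  note D_props = density_unit_interval_measure[OF spectral_distr(1), of "indicator S", folded D_def]
  have D: "unit_interval_measure (D z)"
      "f \<in> borel_measurable borel \<Longrightarrow> (\<integral>t. f t \<partial>D z) = (\<integral>t. indicator S t * f t \<partial>spectral_distr z)"
      "measure (D z) S' = (\<integral>t. indicator S t * indicator S' t \<partial>spectral_distr z)"
    for z and f :: "real \<Rightarrow> real"
    by (rule D_props; use S S' in \<open>auto simp: indicator_def\<close>)+
  have D3: "measure (D z) S' = measure (spectral_distr z) (S' \<inter> S)" for z
    unfolding D(3) indicator_inter_arith[symmetric] by (simp add: Int_commute)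
  have "4 * rinner ((T ^^ k) (proj S x)) y = (\<integral>t. t ^ k \<partial>D (x + y)) - (\<integral>t. t ^ k \<partial>D (x - y))" for k
    by (simp add: rinner_proj S form_pow D(2) flip: proj_pow)
  then have "4 * form S' (proj S x) y - measure (D (x + y)) S' + measure (D (x - y)) S' = 0"
    using form_relation[of "[(-1, D (x + y)), (1, D (x - y))]" "[(4, proj S x, y)]", OF _ _ S']
    by (simp add: D(1))
  then have "form S' (proj S x) y = form (S' \<inter> S) x y"
    unfolding D3 form_def by (simp add: field_simps)
  then show "rinner (proj S' (proj S x)) y = rinner (proj (S' \<inter> S) x) y"
    by (simp only: rinner_proj[OF S'] rinner_proj[OF sets.Int[OF S' S]])
qed

lemma norm_proj_sq:
  assumes "S \<in> sets borel"
  shows "(norm (proj S x))\<^sup>2 = measure (spectral_distr x) S"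
proof -
  have "rinner (proj S x) (proj S x) = form S (proj S x) x"
    by (simp add: rinner_proj assms form_commute)
  also have "\<dots> = rinner (proj S (proj S x)) x"
    by (simp add: rinner_proj assms)
  also have "\<dots> = measure (spectral_distr x) S"
    by (simp add: proj_proj assms rinner_proj form_self)
  finally show ?thesis by (simp add: rinner_self)
qed

lemma orthogonal_projection_proj:
  assumes S: "S \<in> sets borel"
  shows "orthogonal_projection (proj S)"
  unfolding orthogonal_projection_def
proof (intro conjI allI bounded_selfadjointI)
  show "proj S (proj S x) = proj S x" for x by (simp add: proj_proj S)
  show "bounded_linear (proj S)"
  proof (rule bounded_linear_intro[where K = 1])
    show "proj S (x + y) = proj S x + proj S y" for x y
      by (rule rinner_eqI) (simp add: rinner_add_left rinner_proj S form_add_left)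
    show "proj S (r *\<^sub>R x) = r *\<^sub>R proj S x" for r x
      by (rule rinner_eqI) (simp add: rinner_scaleR_left rinner_proj S form_scaleR_left)
    show "norm (proj S x) \<le> norm x * 1" for x
      using norm_proj_sq[OF S, of x] measure_spectral_distr_le[of x S]
      by (simp add: power2_le_imp_le)
  qed
  show "proj S (\<i> *\<^sub>C x) = \<i> *\<^sub>C proj S x" for x
  proof (rule rinner_eqI)
    fix y
    \<comment> \<open>Moving \<i> to the second argument costs a sign; invariance of the form under
      multiplying both arguments by \<i> then brings it back to x.\<close>
    have "rinner (\<i> *\<^sub>C proj S x) y = form S x (- (\<i> *\<^sub>C y))"
      by (simp add: rinner_imag_left rinner_proj[OF S, symmetric] rinner.minus_right)
    also have "\<dots> = form S (\<i> *\<^sub>C x) (\<i> *\<^sub>C (- (\<i> *\<^sub>C y)))"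
      by (simp only: form_imag[OF S])
    also have "\<i> *\<^sub>C (- (\<i> *\<^sub>C y)) = y"
      by (simp add: scaleC_scaleC)
    finally show "rinner (proj S (\<i> *\<^sub>C x)) y = rinner (\<i> *\<^sub>C proj S x) y"
      by (simp add: rinner_proj[OF S])
  qed
  show "rinner (proj S x) y = rinner x (proj S y)" for x y
    by (metis rinner_proj[OF S] form_commute[OF S] rinner_commute)
qed

lemma proj_UNIV: "proj UNIV x = x"
  by (rule rinner_eqI) (simp add: rinner_proj form_def measure_spectral_distr_UNIV rinner_polar[symmetric])

lemma proj_disjoint_Un:
  assumes "S \<in> sets borel" "S' \<in> sets borel" "S \<inter> S' = {}"
  shows "proj (S \<union> S') x = proj S x + proj S' x"
  by (rule rinner_eqI)
    (simp add: assms rinner_proj[OF assms(1)] rinner_proj[OF assms(2)] rinner_proj[OF sets.Un[OF assms(1,2)]]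
      rinner_add_left form_def spectral_distr.finite_measure_Union add_divide_distrib diff_divide_distrib)

text \<open>The squared norm of the tail is the measure of the part of the union not yet covered,
  which tends to 0 by continuity of the finite measure.\<close>

lemma proj_sums:
  fixes F :: "nat \<Rightarrow> real set"
  assumes F: "range F \<subseteq> sets borel" "disjoint_family F"
  shows "(\<lambda>n. proj (F n) x) sums proj (\<Union>n. F n) x"
proof -
  have F': "F n \<in> sets borel" for n using F(1) by blast
  have U: "(\<Union>n. F n) \<in> sets borel" "(\<Union>k<n. F k) \<in> sets borel" for n
    by (auto simp: F')
  note D = sets.Diff[OF U]
  have partial: "(\<Sum>k<n. proj (F k) x) = proj (\<Union>k<n. F k) x" for n
  proof (induction n)
    case 0
    have "(norm (proj {} x))\<^sup>2 = 0" by (simp add: norm_proj_sq)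
    then show ?case by simp
  next
    case (Suc n)
    have "proj (\<Union>k<Suc n. F k) x = proj ((\<Union>k<n. F k) \<union> F n) x"
      by (rule arg_cong[where f = "\<lambda>S. proj S x"]) (auto simp: lessThan_Suc)
    also have "\<dots> = proj (\<Union>k<n. F k) x + proj (F n) x"
    proof (rule proj_disjoint_Un)
      have "F k \<inter> F n = {}" if "k < n" for k
        using disjoint_family_onD[OF F(2), of k n] that by simp
      then show "(\<Union>k<n. F k) \<inter> F n = {}" by blast
    qed (auto simp: F')
    finally show ?case using Suc by simp
  qed
  have diff: "(norm (proj (\<Union>k<n. F k) x - proj (\<Union>n. F n) x))\<^sup>2 =
      measure (spectral_distr x) (\<Union>n. F n) - measure (spectral_distr x) (\<Union>k<n. F k)" for n
  proof -
    have "proj (\<Union>n. F n) x = proj ((\<Union>k<n. F k) \<union> ((\<Union>n. F n) - (\<Union>k<n. F k))) x"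
      by (rule arg_cong[where f = "\<lambda>S. proj S x"]) auto
    also have "\<dots> = proj (\<Union>k<n. F k) x + proj ((\<Union>n. F n) - (\<Union>k<n. F k)) x"
      by (intro proj_disjoint_Un D U) auto
    finally have "(norm (proj (\<Union>k<n. F k) x - proj (\<Union>n. F n) x))\<^sup>2 =
        measure (spectral_distr x) ((\<Union>n. F n) - (\<Union>k<n. F k))"
      by (simp add: norm_proj_sq[OF D])
    also have "\<dots> = measure (spectral_distr x) (\<Union>n. F n) - measure (spectral_distr x) (\<Union>k<n. F k)"
      by (intro spectral_distr.finite_measure_Diff) (use U in auto)
    finally show ?thesis .
  qed
  have "(\<lambda>n. measure (spectral_distr x) (\<Union>k<n. F k)) \<longlonglongrightarrow> measure (spectral_distr x) (\<Union>n. \<Union>k<n. F k)"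
    by (rule spectral_distr.finite_Lim_measure_incseq) (auto simp: F' incseq_def intro: less_le_trans)
  moreover have "(\<Union>n. \<Union>k<n. F k) = (\<Union>n. F n)" by auto
  ultimately have "(\<lambda>n. measure (spectral_distr x) (\<Union>k<n. F k)) \<longlonglongrightarrow> measure (spectral_distr x) (\<Union>n. F n)"
    by simp
  from tendsto_diff[OF tendsto_const[of "measure (spectral_distr x) (\<Union>n. F n)"] this]
  have "(\<lambda>n. measure (spectral_distr x) (\<Union>n. F n) - measure (spectral_distr x) (\<Union>k<n. F k)) \<longlonglongrightarrow> 0"
    by simp
  then have "(\<lambda>n. (norm (proj (\<Union>k<n. F k) x - proj (\<Union>n. F n) x))\<^sup>2) \<longlonglongrightarrow> 0"
    by (simp add: diff)
  then have "(\<lambda>n. proj (\<Union>k<n. F k) x - proj (\<Union>n. F n) x) \<longlonglongrightarrow> 0"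
    by (simp add: tendsto_norm_zero_iff)
  then show ?thesis
    unfolding sums_def partial by (rule LIM_zero_cancel)
qed

lemma proj_Icc: "proj {0..1} x = x"
proof -
  have "AE t in spectral_distr x. t \<in> {0..1}"
    using spectral_distr(1) by (simp add: unit_interval_measure_def)
  then have "measure (spectral_distr x) (- {0..1}) = 0"
    by (subst (asm) AE_iff_measurable[of "- {0..1}"]) (auto simp: measure_def)
  then have "proj (- {0..1}) x = 0"
    using norm_proj_sq[of "- {0..1}" x] by simp
  then show ?thesis
    using proj_disjoint_Un[of "{0..1}" "- {0..1}" x] by (simp add: proj_UNIV)
qed

end

section \<open>Spectral measures of arbitrary bounded self-adjoint operators\<close>

lemma scalar_measure_eqI:
  assumes "finite_measure M" "sets M = sets borel" "\<And>S. S \<in> sets borel \<Longrightarrow> (norm (E S x))\<^sup>2 = measure M S"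
  shows "scalar_measure E x = M"
proof -
  interpret finite_measure M by fact
  have space: "space M = UNIV" using sets_eq_imp_space_eq[OF assms(2)] by simp
  have sig: "sigma_sets UNIV (sets borel) = sets (borel :: real measure)"
    using sets.sigma_sets_eq[of "borel :: real measure"] by simp
  have "scalar_measure E x = measure_of UNIV (sets borel) (emeasure M)"
    unfolding scalar_measure_def
    by (rule measure_of_eq) (auto simp: sig assms(3) emeasure_eq_measure)
  also have "\<dots> = M"
    using measure_of_of_measure[of M] by (simp add: space assms(2))
  finally show ?thesis .
qed

text \<open>With a bound \<open>c\<close> for the norm, T' = (T + c) / (2 c) lies between 0 and 1.
  Its projections are transported by \<open>g\<close>, the inverse of this rescaling, so the scalar
  measures become image measures under \<open>g\<close>.\<close>

theorem spectral_theorem: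
  fixes T :: "'a::complex_hilbert_space \<Rightarrow> 'a"
  assumes T: "bounded_selfadjoint T"
  shows "\<exists>E. is_spectral_measure T E"
proof -
  interpret T: bounded_linear T by (rule bounded_selfadjointD(1)[OF T])
  obtain c where c: "c > 0" and bound: "\<And>x. norm (T x) \<le> norm x * c"
    using T.pos_bounded by blast
  define T' where "T' x = (1 / (2 * c)) *\<^sub>R (T x + c *\<^sub>R x)" for x
  have quad: "rinner (T' x) x = (rinner (T x) x + c * (norm x)\<^sup>2) / (2 * c)" for x
    by (simp add: T'_def rinner_scaleR_left rinner_add_left rinner_self del: inverse_eq_divide)
  have le: "\<bar>rinner (T x) x\<bar> \<le> c * (norm x)\<^sup>2" for x
    using rinner_le_norm[of "T x" x] mult_right_mono[OF bound[of x] norm_ge_zero[of x]]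
    by (simp add: power2_eq_square mult_ac)
  interpret T': unit_selfadjoint T'
  proof
    show "bounded_selfadjoint T'"
    proof (rule bounded_selfadjointI)
      show "bounded_linear T'"
        unfolding T'_def by (intro bounded_linear_intros T.bounded_linear)
      show "T' (\<i> *\<^sub>C x) = \<i> *\<^sub>C T' x" for x
        by (simp add: T'_def bounded_selfadjointD(2)[OF T] scaleC_add_right scaleC_scaleC mult.commute
            flip: scaleC_of_real)
      show "rinner (T' x) y = rinner x (T' y)" for x y
        by (simp add: T'_def rinner_scaleR_left rinner_scaleR_right rinner_add_left rinner_add_right
            bounded_selfadjointD(4)[OF T])
    qed
    show "0 \<le> rinner (T' x) x" for x
      unfolding quad using le[of x] c by (intro divide_nonneg_pos) auto
    show "rinner (T' x) x \<le> (norm x)\<^sup>2" for x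
      unfolding quad using le[of x] c by (simp add: divide_le_eq abs_le_iff)
  qed
  define g where "g s = 2 * c * s - c" for s
  have [measurable]: "g \<in> borel_measurable borel"
    unfolding g_def by measurable
  define E where "E S = T'.proj (g -` S)" for S
  have vimage: "g -` S \<in> sets borel" if "S \<in> sets borel" for S
    using measurable_sets[OF \<open>g \<in> borel_measurable borel\<close> that] by simp
  have pvm: "projection_valued_measure E"
    unfolding projection_valued_measure_def
  proof (intro conjI allI ballI impI)
    show "orthogonal_projection (E S)" if "S \<in> sets borel" for S
      unfolding E_def by (intro T'.orthogonal_projection_proj vimage that)
    show "E UNIV x = x" for x by (simp add: E_def T'.proj_UNIV)
    show "E (S \<inter> S') x = E S (E S' x)" if "S \<in> sets borel" "S' \<in> sets borel" for S S' x
      by (simp add: E_def T'.proj_proj vimage that vimage_Int)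
    show "(\<lambda>n. E (F n) x) sums E (\<Union>n. F n) x"
      if F: "range F \<subseteq> sets borel" "disjoint_family F" for F :: "nat \<Rightarrow> real set" and x
      unfolding E_def vimage_UN
    proof (rule T'.proj_sums)
      show "range (\<lambda>n. g -` F n) \<subseteq> sets borel" using F(1) vimage by blast
      show "disjoint_family (\<lambda>n. g -` F n)" using F(2) by (auto simp: disjoint_family_on_def)
    qed
  qed
  have scalar: "scalar_measure E x = distr (T'.spectral_distr x) borel g" for x
  proof (rule scalar_measure_eqI)
    show "finite_measure (distr (T'.spectral_distr x) borel g)"
      by (rule T'.spectral_distr.finite_measure_distr) simp
    show "(norm (E S x))\<^sup>2 = measure (distr (T'.spectral_distr x) borel g) S" if "S \<in> sets borel" for S
      by (simp add: E_def T'.norm_proj_sq vimage that measure_distr)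
  qed simp
  have "E {-c..c} x = x" for x
  proof -
    have "g -` {-c..c} = {0..1}"
      using c by (auto simp: g_def zero_le_mult_iff)
    then show ?thesis by (simp add: E_def T'.proj_Icc)
  qed
  moreover have "cinner (T x) x = complex_of_real (\<integral>t. t \<partial>scalar_measure E x)" for x
  proof -
    have "integrable (T'.spectral_distr x) (\<lambda>s. s)"
      by (rule unit_interval_measure_integrable[OF T'.spectral_distr(1), where B = 1]) auto
    then have "(\<integral>s. g s \<partial>T'.spectral_distr x) = 2 * c * (\<integral>s. s \<partial>T'.spectral_distr x) - c * (norm x)\<^sup>2"
      unfolding g_def by (simp add: T'.measure_spectral_distr_UNIV)
    moreover have "(\<integral>t. t \<partial>scalar_measure E x) = (\<integral>s. g s \<partial>T'.spectral_distr x)"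
      unfolding scalar by (rule integral_distr) auto
    ultimately have "(\<integral>t. t \<partial>scalar_measure E x) = 2 * c * (\<integral>s. s \<partial>T'.spectral_distr x) - c * (norm x)\<^sup>2"
      by simp
    also have "\<dots> = rinner (T x) x"
      using T'.spectral_distr(2)[of x 1] c by (simp add: quad)
    finally show ?thesis by (simp add: cinner_selfadjoint_real[OF T])
  qed
  ultimately show ?thesis
    using pvm unfolding is_spectral_measure_def by blast
qed

section \<open>Spectral projections and the essential spectrum\<close>

text \<open>\<open>E\<close> is any spectral measure of \<open>T\<close>, not the one constructed
  above, since \<open>spectral_measure\<close> is an arbitrary choice. Commutation of
  \<open>T\<close> with the projections therefore has to be recovered from the quadratic
  form.\<close>

locale spectral_resolution =
  fixes T :: "'a::complex_hilbert_space \<Rightarrow> 'a" and E :: "real set \<Rightarrow> 'a \<Rightarrow> 'a"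
  assumes selfadj: "bounded_selfadjoint T" and spectral: "is_spectral_measure T E"
begin

sublocale T: bounded_linear T
  by (rule bounded_selfadjointD(1)[OF selfadj])

lemma sym: "rinner (T x) y = rinner x (T y)"
  by (rule bounded_selfadjointD(4)[OF selfadj])

lemma pvm: "projection_valued_measure E"
  using spectral by (simp add: is_spectral_measure_def)

lemma E_selfadj: "S \<in> sets borel \<Longrightarrow> bounded_selfadjoint (E S)"
  and E_idem: "S \<in> sets borel \<Longrightarrow> E S (E S x) = E S x"
  using pvm by (auto simp: projection_valued_measure_def orthogonal_projection_def)

lemma E_linear: "S \<in> sets borel \<Longrightarrow> bounded_linear (E S)"
  and E_scaleC: "S \<in> sets borel \<Longrightarrow> E S (c *\<^sub>C x) = c *\<^sub>C E S x"
  and E_sym: "S \<in> sets borel \<Longrightarrow> rinner (E S x) y = rinner x (E S y)"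
  and E_csym: "S \<in> sets borel \<Longrightarrow> cinner (E S x) y = cinner x (E S y)"
  by (erule bounded_selfadjointD[OF E_selfadj])+

lemma E_UNIV: "E UNIV x = x"
  and E_Int: "S \<in> sets borel \<Longrightarrow> S' \<in> sets borel \<Longrightarrow> E S (E S' x) = E (S \<inter> S') x"
  using pvm by (auto simp: projection_valued_measure_def)

lemma E_sums:
  fixes F :: "nat \<Rightarrow> real set"
  shows "range F \<subseteq> sets borel \<Longrightarrow> disjoint_family F \<Longrightarrow> (\<lambda>n. E (F n) x) sums E (\<Union>n. F n) x"
  using pvm unfolding projection_valued_measure_def by blast

lemma E_empty: "E {} x = 0"
proof -
  have "(\<lambda>n::nat. E {} x) sums E (\<Union>n::nat. {}) x"
    by (rule E_sums) (auto simp: disjoint_family_on_def)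
  then have "(\<lambda>n::nat. E {} x) \<longlonglongrightarrow> 0"
    by (intro summable_LIMSEQ_zero) (rule sums_summable)
  then show ?thesis by (simp add: LIMSEQ_const_iff)
qed

lemma E_Un:
  assumes "S \<in> sets borel" "S' \<in> sets borel" "S \<inter> S' = {}"
  shows "E (S \<union> S') x = E S x + E S' x"
proof -
  have "(\<lambda>n. E (binaryset S S' n) x) sums E (\<Union>n. binaryset S S' n) x"
    by (rule E_sums) (use assms in \<open>auto simp: range_binaryset_eq disjoint_family_on_def binaryset_def\<close>)
  moreover have "(\<lambda>n. E (binaryset S S' n) x) sums (E S x + E S' x)"
    using binaryset_sums[of "\<lambda>S. E S x" S S'] by (simp add: E_empty)
  ultimately show ?thesis
    by (simp add: UN_binaryset_eq sums_unique2)
qed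

lemma E_Compl: "S \<in> sets borel \<Longrightarrow> x = E S x + E (- S) x"
  using E_Un[of S "- S" x] by (simp add: E_UNIV)

lemma E_mono:
  assumes "S \<in> sets borel" "S' \<in> sets borel" "S \<subseteq> S'" "E S x = x"
  shows "E S' x = x"
  using E_Int[of S' S x] assms by (simp add: Int_absorb1)

lemma E_disjoint:
  assumes "S \<in> sets borel" "S' \<in> sets borel" "S \<inter> S' = {}" "E S' x = x"
  shows "E S x = 0"
  using E_Int[of S S' x] assms by (simp add: E_empty)

lemma norm_E_sq: "S \<in> sets borel \<Longrightarrow> (norm (E S x))\<^sup>2 = rinner (E S x) x"
  by (metis E_idem E_sym rinner_self)

lemma emeasure_scalar:
  assumes "S \<in> sets borel"
  shows "emeasure (scalar_measure E x) S = ennreal ((norm (E S x))\<^sup>2)"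
  unfolding scalar_measure_def
proof (rule emeasure_measure_of_sigma[OF _ _ _ assms])
  show "sigma_algebra UNIV (sets (borel :: real measure))"
    using sets.sigma_algebra_axioms[of "borel :: real measure"] by simp
  show "positive (sets borel) (\<lambda>S. ennreal ((norm (E S x))\<^sup>2))"
    by (simp add: positive_def E_empty)
  show "countably_additive (sets borel) (\<lambda>S. ennreal ((norm (E S x))\<^sup>2))"
    unfolding countably_additive_def
  proof (intro allI impI)
    fix F :: "nat \<Rightarrow> real set"
    assume F: "range F \<subseteq> sets borel" "disjoint_family F" "\<Union> (range F) \<in> sets borel"
    have F': "F n \<in> sets borel" for n using F(1) by blast
    \<comment> \<open>The squared norm equals an expression linear in the projection, so strong
      convergence of the series is enough.\<close>
    have "(\<lambda>n. rinner (E (F n) x) x) sums rinner (E (\<Union>n. F n) x) x"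
      by (rule bounded_linear.sums[OF rinner.bounded_linear_left E_sums[OF F(1,2)]])
    then have "(\<lambda>n. (norm (E (F n) x))\<^sup>2) sums (norm (E (\<Union>n. F n) x))\<^sup>2"
      by (simp only: norm_E_sq[OF F'] norm_E_sq[OF F(3)])
    then show "(\<Sum>i. ennreal ((norm (E (F i) x))\<^sup>2)) = ennreal ((norm (E (\<Union> (range F)) x))\<^sup>2)"
      by (intro suminf_ennreal_eq) auto
  qed
qed

lemma sets_scalar [simp, measurable_cong]: "sets (scalar_measure E x) = sets borel"
  unfolding scalar_measure_def using sets.sigma_sets_eq[of "borel :: real measure"] by simp

lemma space_scalar [simp]: "space (scalar_measure E x) = UNIV"
  using sets_eq_imp_space_eq[OF sets_scalar] by simp

sublocale scalar: finite_measure "scalar_measure E x" for x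
  by (rule finite_measureI) (simp add: emeasure_scalar)

lemma measure_scalar: "S \<in> sets borel \<Longrightarrow> measure (scalar_measure E x) S = (norm (E S x))\<^sup>2"
  by (simp add: measure_def emeasure_scalar)

lemma AE_scalar:
  assumes S: "S \<in> sets borel" and "E S x = x"
  shows "AE t in scalar_measure E x. t \<in> S"
proof -
  have "E (- S) x = 0" using E_Compl[OF S, of x] assms(2) by simp
  then have "emeasure (scalar_measure E x) (- S) = 0"
    using S by (simp add: emeasure_scalar)
  then show ?thesis
    using S by (intro AE_I[of _ _ "- S"]) auto
qed

lemma integrable_scalar: "integrable (scalar_measure E x) (\<lambda>t. t)"
proof -
  obtain M where "\<And>x. E {-M..M} x = x"
    using spectral unfolding is_spectral_measure_def by blast
  then have "AE t in scalar_measure E x. t \<in> {-M..M}"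
    by (intro AE_scalar) auto
  then have "AE t in scalar_measure E x. norm t \<le> M"
    by eventually_elim auto
  then show ?thesis
    by (rule scalar.integrable_const_bound) simp
qed

lemma quadratic_form: "rinner (T x) x = (\<integral>t. t \<partial>scalar_measure E x)"
  using spectral by (simp add: is_spectral_measure_def rinner_def)

text \<open>The scalar measure of \<open>E S x\<close> is that of \<open>x\<close> restricted to
  \<open>S\<close>.\<close>

lemma quadratic_form_E:
  assumes S: "S \<in> sets borel"
  shows "rinner (T (E S x)) (E S x) = (\<integral>t. indicator S t * t \<partial>scalar_measure E x)"
proof -
  have "scalar_measure E (E S x) = density (scalar_measure E x) (\<lambda>t. ennreal (indicator S t))"
  proof (rule measure_eqI)
    fix S' assume "S' \<in> sets (scalar_measure E (E S x))"
    then have S': "S' \<in> sets borel" by simp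
    have "emeasure (scalar_measure E (E S x)) S' = emeasure (scalar_measure E x) (S \<inter> S')"
      using S S' by (simp add: emeasure_scalar E_Int Int_commute)
    also have "\<dots> = (\<integral>\<^sup>+t. indicator (S \<inter> S') t \<partial>scalar_measure E x)"
      using S S' by simp
    also have "\<dots> = (\<integral>\<^sup>+t. ennreal (indicator S t) * indicator S' t \<partial>scalar_measure E x)"
      by (intro nn_integral_cong) (auto simp: indicator_def)
    also have "\<dots> = emeasure (density (scalar_measure E x) (\<lambda>t. ennreal (indicator S t))) S'"
      using S S' by (subst emeasure_density) auto
    finally show "emeasure (scalar_measure E (E S x)) S' =
       emeasure (density (scalar_measure E x) (\<lambda>t. ennreal (indicator S t))) S'" .
  qed simp
  then show ?thesis
    using S by (simp add: quadratic_form integral_density)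
qed

text \<open>The integral for u + v splits over \<open>S\<close> and its complement into the
  quadratic forms of u and v; comparison with the bilinear expansion kills the cross term.\<close>

lemma T_E_orthogonal:
  assumes S: "S \<in> sets borel" and u: "E S u = u" and v: "E (- S) v = v"
  shows "rinner (T u) v = 0"
proof -
  have S': "- S \<in> sets borel" using S by auto
  interpret ES: bounded_linear "E S" by (rule E_linear[OF S])
  interpret ES': bounded_linear "E (- S)" by (rule E_linear[OF S'])
  have "E S v = 0" "E (- S) u = 0"
    by (rule E_disjoint[OF S S' _ v], simp) (rule E_disjoint[OF S' S _ u], simp)
  then have uv: "E S (u + v) = u" "E (- S) (u + v) = v"
    using u v by (simp_all add: ES.add ES'.add)
  have int: "integrable (scalar_measure E (u + v)) (\<lambda>t. indicator S t * t)"
    if "S \<in> sets borel" for S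
    using integrable_mult_indicator[OF _ integrable_scalar, of S] that by simp
  have "rinner (T (u + v)) (u + v) = (\<integral>t. indicator S t * t + indicator (- S) t * t \<partial>scalar_measure E (u + v))"
    unfolding quadratic_form by (intro Bochner_Integration.integral_cong) (auto simp: indicator_def)
  also have "\<dots> = rinner (T u) u + rinner (T v) v"
    using quadratic_form_E[OF S, of "u + v"] quadratic_form_E[OF S', of "u + v"] int[OF S] int[OF S'] uv
    by simp
  finally show ?thesis
    using sym[of u v] rinner_commute[of u "T v"] by (simp add: T.add rinner_add_left rinner_add_right)
qed

lemma T_invariant:
  assumes S: "S \<in> sets borel" and u: "E S u = u"
  shows "E S (T u) = T u"
proof -
  have S': "- S \<in> sets borel" using S by auto
  have "rinner (E (- S) (T u)) y = rinner 0 y" for y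
    using T_E_orthogonal[OF S u E_idem[OF S']] by (simp add: E_sym[OF S'] rinner.zero_left)
  then have "E (- S) (T u) = 0" by (rule rinner_eqI)
  then show ?thesis using E_Compl[OF S, of "T u"] by simp
qed

lemma E_T_commute:
  assumes S: "S \<in> sets borel"
  shows "E S (T x) = T (E S x)"
proof -
  have S': "- S \<in> sets borel" using S by auto
  interpret ES: bounded_linear "E S" by (rule E_linear[OF S])
  have "E S (T x) = E S (T (E S x + E (- S) x))"
    using E_Compl[OF S, of x] by simp
  also have "\<dots> = E S (T (E S x)) + E S (T (E (- S) x))"
    by (simp add: T.add ES.add)
  also have "E S (T (E S x)) = T (E S x)"
    by (rule T_invariant[OF S E_idem[OF S]])
  also have "E S (T (E (- S) x)) = 0"
    by (rule E_disjoint[OF S S' _ T_invariant[OF S' E_idem[OF S']]]) auto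
  finally show ?thesis by simp
qed

lemma quadratic_form_bounds:
  assumes S: "S \<in> sets borel" and u: "E S u = u"
  shows "S \<subseteq> {..b} \<Longrightarrow> rinner (T u) u \<le> b * (norm u)\<^sup>2"
    and "S \<subseteq> {a..} \<Longrightarrow> a * (norm u)\<^sup>2 \<le> rinner (T u) u"
proof -
  have AE: "AE t in scalar_measure E u. t \<in> S" by (rule AE_scalar[OF S u])
  have const: "(\<integral>t. c \<partial>scalar_measure E u) = c * (norm u)\<^sup>2" for c
    by (simp add: measure_scalar E_UNIV)
  show "rinner (T u) u \<le> b * (norm u)\<^sup>2" if "S \<subseteq> {..b}"
    unfolding quadratic_form const[symmetric]
    by (intro integral_mono_AE integrable_scalar) (use AE that in \<open>auto elim!: eventually_mono\<close>)
  show "a * (norm u)\<^sup>2 \<le> rinner (T u) u" if "S \<subseteq> {a..}"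
    unfolding quadratic_form const[symmetric]
    by (intro integral_mono_AE integrable_scalar) (use AE that in \<open>auto elim!: eventually_mono\<close>)
qed

text \<open>With \<open>B = T - m\<close> one has
  \<open>(r + B) (r - B)\<^sup>2 + (r - B) (r + B)\<^sup>2 = 2 r (r\<^sup>2 - B\<^sup>2)\<close>, where the left-hand side is positive.\<close>

lemma norm_le_on_range:
  assumes S: "S \<in> sets borel" "S \<subseteq> {m - r..m + r}" and u: "E S u = u" and r: "r > 0"
  shows "norm (T u - m *\<^sub>R u) \<le> r * norm u"
proof -
  interpret ES: bounded_linear "E S" by (rule E_linear[OF S(1)])
  define B where "B x = T x - m *\<^sub>R x" for x
  have B_lin: "B (x + y) = B x + B y" "B (x - y) = B x - B y" "B (c *\<^sub>R x) = c *\<^sub>R B x" for x y c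
    by (auto simp: B_def T.add T.diff T.scaleR algebra_simps)
  have B_sym: "rinner (B x) y = rinner x (B y)" for x y
    by (simp add: B_def rinner.diff_left rinner.diff_right rinner_scaleR_left rinner_scaleR_right sym)
  have inv: "E S (B w) = B w" if "E S w = w" for w
    using T_invariant[OF S(1) that] that by (simp add: B_def ES.diff ES.scaleR)
  have bounds: "rinner (B w) w \<le> r * rinner w w" "- r * rinner w w \<le> rinner (B w) w" if "E S w = w" for w
  proof -
    have "S \<subseteq> {..m + r}" "S \<subseteq> {m - r..}" using S(2) by auto
    from quadratic_form_bounds(1)[OF S(1) that this(1)] quadratic_form_bounds(2)[OF S(1) that this(2)]
    show "rinner (B w) w \<le> r * rinner w w" "- r * rinner w w \<le> rinner (B w) w"
      by (auto simp: B_def rinner.diff_left rinner_scaleR_left rinner_self algebra_simps)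
  qed
  have *: "E S (r *\<^sub>R u + B u) = r *\<^sub>R u + B u" "E S (r *\<^sub>R u - B u) = r *\<^sub>R u - B u"
    by (simp_all add: ES.add ES.diff ES.scaleR u inv)
  have c: "rinner (B (B u)) u = rinner (B u) (B u)" "rinner (B (B u)) (B u) = rinner (B u) (B (B u))"
      "rinner u (B u) = rinner (B u) u"
    using B_sym[of "B u" u] B_sym[of u u] rinner_commute by metis+
  have "0 \<le> r * rinner (r *\<^sub>R u - B u) (r *\<^sub>R u - B u) + rinner (B (r *\<^sub>R u - B u)) (r *\<^sub>R u - B u) +
      (r * rinner (r *\<^sub>R u + B u) (r *\<^sub>R u + B u) - rinner (B (r *\<^sub>R u + B u)) (r *\<^sub>R u + B u))"
    using bounds(1)[OF *(1)] bounds(2)[OF *(2)] by simp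
  also have "\<dots> = (2 * r) * (r\<^sup>2 * rinner u u - rinner (B u) (B u))"
    by (simp add: B_lin rinner_add_left rinner_add_right rinner.diff_left rinner.diff_right
        rinner_scaleR_left rinner_scaleR_right c power2_eq_square algebra_simps)
  finally have "0 \<le> r\<^sup>2 * rinner u u - rinner (B u) (B u)"
    using r by (simp add: zero_le_mult_iff)
  then have "(norm (B u))\<^sup>2 \<le> (r * norm u)\<^sup>2"
    by (simp add: rinner_self power_mult_distrib)
  then have "norm (B u) \<le> r * norm u"
    by (rule power2_le_imp_le) (use r in simp)
  then show ?thesis by (simp add: B_def)
qed

text \<open>Split u = p + q into its parts above and below m. Testing T u - m u against the
  reflected vector p - q, which has the same norm as u, makes both contributions positive.\<close>

lemma norm_ge_on_range:
  assumes S: "S \<in> sets borel" "\<And>t. t \<in> S \<Longrightarrow> r \<le> \<bar>t - m\<bar>" and u: "E S u = u"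
  shows "r * norm u \<le> norm (T u - m *\<^sub>R u)"
proof (cases "u = 0")
  case True
  then show ?thesis by simp
next
  case False
  define P where "P = S \<inter> {m..}"
  define Q where "Q = S \<inter> {..<m}"
  have PQ: "P \<in> sets borel" "Q \<in> sets borel" "- P \<in> sets borel" "P \<inter> Q = {}" "Q \<subseteq> - P"
    using S(1) by (auto simp: P_def Q_def)
  define p q where "p = E P u" and "q = E Q u"
  have p: "E P p = p" and q: "E Q q = q"
    by (simp_all add: p_def q_def E_idem PQ)
  have "P \<union> Q = S" by (auto simp: P_def Q_def)
  then have upq: "u = p + q"
    using E_Un[OF PQ(1,2,4), of u] u by (simp add: p_def q_def)
  have q': "E (- P) q = q" by (rule E_mono[OF PQ(2,3,5) q])
  have cross: "rinner (T p) q = 0" "rinner (T q) p = 0"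
    using T_E_orthogonal[OF PQ(1) p q'] sym[of q p] rinner_commute[of q "T p"] by auto
  have orth: "rinner p q = 0" "rinner q p = 0"
  proof -
    have "rinner p q = rinner p (E P q)" using p E_sym[OF PQ(1), of p q] by simp
    also have "E P q = 0" by (rule E_disjoint[OF PQ(1,2,4) q])
    finally show "rinner p q = 0" by (simp add: rinner.zero_right)
    then show "rinner q p = 0" by (simp add: rinner_commute)
  qed
  have "P \<subseteq> {m + r..}" "Q \<subseteq> {..m - r}"
    using S(2) by (force simp: P_def Q_def)+
  then have bp: "(m + r) * (norm p)\<^sup>2 \<le> rinner (T p) p" and bq: "rinner (T q) q \<le> (m - r) * (norm q)\<^sup>2"
    using quadratic_form_bounds(2)[OF PQ(1) p] quadratic_form_bounds(1)[OF PQ(2) q] by blast+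
  have norms: "(norm u)\<^sup>2 = (norm p)\<^sup>2 + (norm q)\<^sup>2" "(norm (p - q))\<^sup>2 = (norm p)\<^sup>2 + (norm q)\<^sup>2"
    by (simp_all add: upq norm_add_sq norm_diff_sq orth)
  then have "norm (p - q) = norm u"
    by (metis norm_ge_zero power2_eq_imp_eq)
  have "r * (norm u)\<^sup>2 \<le> rinner (T u - m *\<^sub>R u) (p - q)"
    using bp bq unfolding norms(1)
    by (simp add: upq T.add rinner.diff_left rinner.diff_right rinner_add_left rinner_scaleR_left cross orth rinner_self algebra_simps)
  also have "\<dots> \<le> norm (T u - m *\<^sub>R u) * norm u"
    using rinner_le_norm[of "T u - m *\<^sub>R u" "p - q"] \<open>norm (p - q) = norm u\<close> by simp
  finally show ?thesis
    using False by (simp add: power2_eq_square)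
qed

lemma E_range_iff: "S \<in> sets borel \<Longrightarrow> x \<in> range (E S) \<longleftrightarrow> E S x = x"
  by (metis E_idem rangeE rangeI)

lemma E_eq_0_iff: "S \<in> sets borel \<Longrightarrow> E S x = 0 \<longleftrightarrow> emeasure (scalar_measure E x) S = 0"
  by (simp add: emeasure_scalar)

lemma subspace_range_E: "S \<in> sets borel \<Longrightarrow> complex_vector.subspace (range (E S))"
  using linear_add[OF bounded_linear.linear[OF E_linear]] linear_0[OF bounded_linear.linear[OF E_linear]]
  by (auto simp: complex_vector.subspace_def E_range_iff E_scaleC)

end

section \<open>Spectrum, approximate eigenvectors and spectral projections\<close>

text \<open>The quadratic form is real, so the imaginary part of z contributes an orthogonal
  summand.\<close>

lemma norm_diff_scaleC_sq:
  assumes T: "bounded_selfadjoint T"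
  shows "(norm (T x - z *\<^sub>C x))\<^sup>2 = (norm (T x - Re z *\<^sub>R x))\<^sup>2 + (Im z)\<^sup>2 * (norm x)\<^sup>2"
proof -
  have eq: "T x - z *\<^sub>C x = (T x - Re z *\<^sub>R x) - Im z *\<^sub>R (\<i> *\<^sub>C x)"
    by (subst scaleC_eq) simp
  have orth: "rinner (T x - Re z *\<^sub>R x) (\<i> *\<^sub>C x) = 0"
    unfolding rinner.diff_left rinner_scaleR_left
    unfolding rinner_imag_right cinner_selfadjoint_real[OF T] cinner_self
    by simp
  show ?thesis
    unfolding eq norm_diff_scaleR_sq[of "T x - Re z *\<^sub>R x"] orth by (simp add: norm_scaleC)
qed

text \<open>Both claims follow from one fact: if T - z is bounded below, it has a bounded inverse.
  For nonreal z the lower bound is the absolute value of Im z.\<close>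

lemma spectrum_imp_real:
  assumes T: "bounded_selfadjoint T" and z: "z \<in> spectrum T"
  shows "z = complex_of_real (Re z)"
    and "r > 0 \<Longrightarrow> \<exists>x. norm (T x - Re z *\<^sub>R x) < r * norm x"
proof -
  note D = bounded_selfadjointD[OF T]
  interpret T: bounded_linear T by (rule D(1))
  have bounded_below: False if c: "c > 0" and below: "\<And>x. norm (T x - z *\<^sub>C x) \<ge> c * norm x" for c
  proof -
    define f where "f x = T x - z *\<^sub>C x" for x
    have f_lin: "bounded_linear f"
      unfolding f_def by (intro bounded_linear_sub T.bounded_linear bounded_linear_scaleC)
    interpret f: bounded_linear f by (rule f_lin)
    have f_scaleC: "f (d *\<^sub>C x) = d *\<^sub>C f x" for d x
      by (simp add: f_def D(2) complex_vector.scale_right_diff_distrib scaleC_scaleC mult.commute)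
    have inj: "x = y" if "f x = f y" for x y
      using below[of "x - y"] that c by (simp add: f.diff mult_le_0_iff flip: f_def)
    \<comment> \<open>A linear map that is bounded below has complete, hence closed, range.\<close>
    have "closed (range f)"
      by (intro complete_imp_closed complete_isometric_image[OF c subspace_UNIV f_lin])
        (use below in \<open>auto simp: f_def complete_UNIV\<close>)
    moreover have "subspace (range f)"
      by (rule linear_subspace_image[OF f.linear subspace_UNIV]) 
    ultimately have surj: "\<exists>x. f x = y" for y
    proof -
      obtain u where u: "u \<in> range f" "\<And>m. m \<in> range f \<Longrightarrow> rinner (y - u) m = 0"
        using projection_exists[OF \<open>subspace (range f)\<close> \<open>closed (range f)\<close>] by blast
      define w where "w = y - u"
      \<comment> \<open>The residual w is orthogonal to the range of T - z, so the adjoint T - cnj z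
        annihilates it.\<close>
      have "rinner (T w - cnj z *\<^sub>C w) x = rinner 0 x" for x
      proof -
        have "rinner (T w - cnj z *\<^sub>C w) x = rinner w (f x)"
          by (simp add: f_def rinner.diff_left rinner.diff_right D(4)) (simp add: rinner_def cinner_scaleC_left cinner_scaleC_right)
        then show ?thesis using u(2)[of "f x"] by (simp add: w_def rinner.zero_left)
      qed
      then have "T w - cnj z *\<^sub>C w = 0" by (rule rinner_eqI)
      \<comment> \<open>By \<open>norm_diff_scaleC_sq\<close> the norm depends only on Re z and (Im
        z)^2, so conjugating z does not change it.\<close>
      then have "norm (T w - z *\<^sub>C w) = 0"
        using norm_diff_scaleC_sq[OF T, of w z] norm_diff_scaleC_sq[OF T, of w "cnj z"] by simp
      then have "w = 0" using below[of w] c by (simp add: mult_le_0_iff)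
      then show ?thesis using u(1) by (auto simp: w_def)
    qed
    then obtain R where R: "\<And>y. f (R y) = y" by metis
    have R_bound: "norm (R y) \<le> norm y * (1 / c)" for y
      using below[of "R y"] R[of y] c by (simp add: field_simps flip: f_def)
    have "bounded_linear R"
    proof (rule bounded_linear_intro[OF _ _ R_bound])
      show "R (x + y) = R x + R y" for x y by (rule inj) (simp add: R f.add)
      show "R (r *\<^sub>R x) = r *\<^sub>R R x" for r x by (rule inj) (simp add: R f.scaleR)
    qed
    moreover have "R (d *\<^sub>C x) = d *\<^sub>C R x" for d x
      by (rule inj) (simp add: R f_scaleC)
    ultimately have "bounded_clinear R"
      by (simp add: bounded_clinear_def)
    moreover have "R (f x) = x" for x by (rule inj) (rule R)
    ultimately have "z \<notin> spectrum T"
      unfolding spectrum_def using R by (auto simp: f_def)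
    then show False using z by simp
  qed
  show real: "z = complex_of_real (Re z)"
  proof (rule ccontr)
    assume "z \<noteq> complex_of_real (Re z)"
    then have "Im z \<noteq> 0" by (simp add: complex_eq_iff)
    moreover have "\<bar>Im z\<bar> * norm x \<le> norm (T x - z *\<^sub>C x)" for x
    proof (rule power2_le_imp_le)
      show "(\<bar>Im z\<bar> * norm x)\<^sup>2 \<le> (norm (T x - z *\<^sub>C x))\<^sup>2"
        unfolding norm_diff_scaleC_sq[OF T] by (simp add: power_mult_distrib)
    qed simp
    ultimately show False using bounded_below[of "\<bar>Im z\<bar>"] by simp
  qed
  show "\<exists>x. norm (T x - Re z *\<^sub>R x) < r * norm x" if "r > 0"
  proof (rule ccontr)
    assume "\<not> ?thesis"
    then have "r * norm x \<le> norm (T x - z *\<^sub>C x)" for x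
      by (subst real) (simp add: scaleC_of_real not_less)
    then show False by (rule bounded_below[OF that])
  qed
qed

lemma not_spectrum_bounded_below:
  assumes "z \<notin> spectrum T"
  obtains c where "c > 0" "\<And>x. c * norm x \<le> norm (T x - z *\<^sub>C x)"
proof -
  obtain R where R: "bounded_clinear R" "\<And>x. R (T x - z *\<^sub>C x) = x"
    using assms unfolding spectrum_def by blast
  then interpret bounded_linear R by (simp add: bounded_clinear_def)
  obtain K where K: "K > 0" "\<And>x. norm (R x) \<le> norm x * K" using pos_bounded by blast
  have "(1 / K) * norm x \<le> norm (T x - z *\<^sub>C x)" for x
    using K(2)[of "T x - z *\<^sub>C x"] R(2)[of x] K(1) by (simp add: field_simps)
  then show thesis using K(1) by (intro that[of "1 / K"]) auto
qed

context spectral_resolution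
begin

lemma spectrum_imp_E_nonzero:
  assumes z: "z \<in> spectrum T" and U: "open U" "Re z \<in> U"
  obtains e where "E U e = e" "e \<noteq> 0"
proof -
  obtain r where r: "r > 0" "ball (Re z) r \<subseteq> U"
    using U open_contains_ball by blast
  obtain x where x: "norm (T x - Re z *\<^sub>R x) < r * norm x"
    using spectrum_imp_real(2)[OF selfadj z r(1)] by blast
  have "E U x \<noteq> 0"
  proof
    assume "E U x = 0"
    then have "E (- U) x = x" using E_Compl[of U x] U(1) by simp
    moreover have "r \<le> \<bar>t - Re z\<bar>" if "t \<in> - U" for t
      using that r(2) by (force simp: dist_real_def)
    ultimately have "r * norm x \<le> norm (T x - Re z *\<^sub>R x)"
      using U(1) by (intro norm_ge_on_range[of "- U"]) auto
    then show False using x by simp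
  qed
  then show thesis
    using U(1) by (intro that[of "E U x"]) (auto simp: E_idem)
qed

text \<open>The kernel of \<open>T\<close> lies in the range. If instead spectral points accumulate
  at 0, disjoint neighbourhoods of arbitrarily many of them have nonzero projections with mutually
  orthogonal ranges.\<close>

lemma infinite_dimensional_range_if_essential_spectrum:
  assumes ess: "0 \<in> essential_spectrum T" and \<epsilon>: "\<epsilon> > 0"
  shows "infinite_dimensional (range (E {-\<epsilon>..\<epsilon>}))"
proof -
  consider "infinite_dimensional {x. T x - 0 *\<^sub>C x = 0}" | "0 islimpt spectrum T"
    using ess by (auto simp: essential_spectrum_def)
  then show ?thesis
  proof cases
    case 1
    have "x \<in> range (E {-\<epsilon>..\<epsilon>})" if "T x = 0" for x
    proof -
      define v where "v = E (- {-\<epsilon>..\<epsilon>}) x"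
      have "T v = E (- {-\<epsilon>..\<epsilon>}) (T x)" by (simp add: v_def E_T_commute)
      also have "\<dots> = 0" unfolding that by (rule linear_0[OF bounded_linear.linear[OF E_linear]]) auto
      finally have "T v = 0" .
      moreover have "\<epsilon> * norm v \<le> norm (T v - 0 *\<^sub>R v)"
        by (rule norm_ge_on_range[of "- {-\<epsilon>..\<epsilon>}"]) (auto simp: v_def E_idem)
      ultimately have "v = 0" using \<epsilon> by (simp add: mult_le_0_iff)
      then have "E {-\<epsilon>..\<epsilon>} x = x"
        using E_Compl[of "{-\<epsilon>..\<epsilon>}" x] by (simp add: v_def)
      then show ?thesis by (simp add: E_range_iff)
    qed
    then have "{x. T x - 0 *\<^sub>C x = 0} \<subseteq> range (E {-\<epsilon>..\<epsilon>})" by auto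
    then show ?thesis using 1 infinite_dimensional_mono by blast
  next
    case 2
    then have inf: "infinite (spectrum T \<inter> ball 0 \<epsilon>)"
      using \<epsilon> by (simp add: islimpt_eq_infinite_ball)
    show ?thesis
    proof (rule infinite_dimensional_of_orthogonal)
      fix n
      obtain F where F: "finite F" "card F = n" "F \<subseteq> spectrum T \<inter> ball 0 \<epsilon>"
        using infinite_arbitrarily_large[OF inf] by blast
      text \<open>Disjoint neighbourhoods of the points of \<open>F\<close>: their Voronoi cells.\<close>
      define U where "U z = {-\<epsilon><..<\<epsilon>} \<inter> (\<Inter>w\<in>F - {z}. {t. \<bar>t - Re z\<bar> < \<bar>t - Re w\<bar>})" for z
      have "open (U z)" for z
        unfolding U_def using F(1)
        by (intro open_Int open_INT ballI open_Collect_less continuous_intros) auto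
      then have [measurable]: "U z \<in> sets borel" for z by simp
      have "Re z \<in> U z" if "z \<in> F" for z
      proof -
        have "\<bar>Re z\<bar> < \<epsilon>" using that F(3) abs_Re_le_cmod[of z] by force
        \<comment> \<open>The spectrum is real, so distinct points keep distinct real parts and each
          lies in its own cell.\<close>
        moreover have "Re z \<noteq> Re w" if "w \<in> F" "w \<noteq> z" for w
          using spectrum_imp_real(1)[OF selfadj] F(3) that \<open>z \<in> F\<close> by (metis IntD1 subsetD)
        ultimately show ?thesis by (auto simp: U_def)
      qed
      then have "\<exists>e. E (U z) e = e \<and> e \<noteq> 0" if "z \<in> F" for z
        using spectrum_imp_E_nonzero[OF _ \<open>open (U z)\<close>] F(3) that by (metis IntD1 subsetD)
      then obtain e where e: "\<And>z. z \<in> F \<Longrightarrow> E (U z) (e z) = e z" "\<And>z. z \<in> F \<Longrightarrow> e z \<noteq> 0"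
        by metis
      have "cinner (e z) (e w) = 0" if zw: "z \<in> F" "w \<in> F" "z \<noteq> w" for z w
      proof -
        have closer: "\<bar>t - Re v\<bar> < \<bar>t - Re v'\<bar>" if "t \<in> U v" "v' \<in> F" "v \<noteq> v'" for t v v'
          using that unfolding U_def by blast
        have "U z \<inter> U w = {}"
        proof (rule equals0I)
          fix t assume "t \<in> U z \<inter> U w"
          then show False
            using closer[of t z w] closer[of t w z] zw by simp
        qed
        then have "E (U z) (e w) = 0" by (intro E_disjoint[OF _ _ _ e(1)[OF zw(2)]]) auto
        then show ?thesis using E_csym[of "U z" "e z" "e w"] e(1)[OF zw(1)] by simp
      qed
      moreover have "e z \<in> range (E {-\<epsilon>..\<epsilon>})" if "z \<in> F" for z
      proof -
        have "U z \<subseteq> {-\<epsilon>..\<epsilon>}" unfolding U_def by auto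
        then have "E {-\<epsilon>..\<epsilon>} (e z) = e z"
          by (rule E_mono[OF _ _ _ e(1)[OF that], rotated 2]) simp_all
        then show ?thesis by (metis rangeI)
      qed
      ultimately show "\<exists>(F :: complex set) e. finite F \<and> card F = n \<and>
          (\<forall>i\<in>F. e i \<in> range (E {-\<epsilon>..\<epsilon>}) \<and> e i \<noteq> 0) \<and> (\<forall>i\<in>F. \<forall>j\<in>F. i \<noteq> j \<longrightarrow> cinner (e i) (e j) = 0)"
        using F(1,2) e(2) by (intro exI[of _ F] exI[of _ e]) simp
    qed
  qed
qed

text \<open>Near a point t outside the spectrum, T - t is bounded below by some c, but on the range
  for the interval of radius c / 2 it is bounded above by c / 2; that range is therefore
  zero.\<close>

lemma E_eq_0_off_spectrum:
  assumes U: "open U" "\<And>t. t \<in> U \<Longrightarrow> complex_of_real t \<notin> spectrum T"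
  shows "E U x = 0"
proof -
  define \<F> where "\<F> = {V. open V \<and> (\<forall>x. E V x = 0)}"
  have "\<exists>V\<in>\<F>. t \<in> V" if t: "t \<in> U" for t
  proof -
    obtain c where c: "c > 0" "\<And>x. c * norm x \<le> norm (T x - complex_of_real t *\<^sub>C x)"
      using not_spectrum_bounded_below[OF U(2)[OF t]] by blast
    have "E {t - c / 2<..<t + c / 2} x = 0" for x
    proof -
      define v where "v = E {t - c / 2<..<t + c / 2} x"
      have "norm (T v - t *\<^sub>R v) \<le> c / 2 * norm v"
        by (rule norm_le_on_range[of "{t - c / 2<..<t + c / 2}"]) (use c(1) in \<open>auto simp: v_def E_idem\<close>)
      then have "c * norm v \<le> c / 2 * norm v" using c(2)[of v] by (simp add: scaleC_of_real)
      then show ?thesis using c(1) by (simp add: v_def)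
    qed
    then show ?thesis
      using c(1) by (intro bexI[of _ "{t - c / 2<..<t + c / 2}"]) (auto simp: \<F>_def)
  qed
  then have U_sub: "U \<subseteq> \<Union>\<F>" by blast
  obtain \<F>' where \<F>': "\<F>' \<subseteq> \<F>" "countable \<F>'" "\<Union>\<F>' = \<Union>\<F>"
    using Lindelof[of \<F>] by (auto simp: \<F>_def)
  have null: "(\<Union>V\<in>\<F>'. V) \<in> null_sets (scalar_measure E x)"
  proof (rule null_sets_UN'[OF \<F>'(2)])
    fix V assume "V \<in> \<F>'"
    then have "open V" "E V x = 0" using \<F>'(1) by (auto simp: \<F>_def)
    then show "V \<in> null_sets (scalar_measure E x)"
      by (auto simp: null_sets_def emeasure_scalar)
  qed
  have "emeasure (scalar_measure E x) U \<le> emeasure (scalar_measure E x) (\<Union>V\<in>\<F>'. V)"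
    using U_sub \<F>'(3) null_setsD2[OF null] by (intro emeasure_mono) auto
  then have "emeasure (scalar_measure E x) U = 0"
    using null_setsD1[OF null] by simp
  then show ?thesis
    using U(1) by (simp add: E_eq_0_iff)
qed

text \<open>Zero is at worst an isolated point of the spectrum with finite-dimensional kernel. Take
  \<open>B\<close> to span the kernel and \<delta> to be the gap: a vector orthogonal to
  \<open>B\<close> then lives on the spectrum at distance at least \<delta> from 0.\<close>

lemma bounded_below_if_not_essential_spectrum:
  assumes "0 \<notin> essential_spectrum T"
  obtains \<delta> B where "\<delta> > 0" "finite B"
    "\<And>x. (\<And>b. b \<in> B \<Longrightarrow> cinner x b = 0) \<Longrightarrow> \<delta> * norm x \<le> norm (T x)"
proof (cases "0 \<in> spectrum T")
  case False
  then obtain c where "c > 0" "\<And>x. c * norm x \<le> norm (T x - 0 *\<^sub>C x)"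
    using not_spectrum_bounded_below by blast
  then show thesis using that[of c "{}"] by simp
next
  case True
  then have "\<not> 0 islimpt spectrum T" "\<not> infinite_dimensional {x. T x - 0 *\<^sub>C x = 0}"
    using assms by (auto simp: essential_spectrum_def)
  then obtain \<delta> B where \<delta>: "\<delta> > 0" "\<And>z. z \<in> spectrum T \<Longrightarrow> z \<noteq> 0 \<Longrightarrow> dist z 0 \<ge> \<delta>"
    and B: "finite B" "{x. T x = 0} \<subseteq> complex_vector.span B"
    unfolding islimpt_approachable infinite_dimensional_def by (auto simp: not_less)
  have "\<delta> * norm x \<le> norm (T x)" if x: "\<And>b. b \<in> B \<Longrightarrow> cinner x b = 0" for x
  proof -
    have x_span: "cinner x y = 0" if "y \<in> complex_vector.span B" for y
      using cinner_span_eq_0[OF that x] .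
    have U0: "E ({-\<delta><..<\<delta>} - {0}) x = 0"
    proof (rule E_eq_0_off_spectrum)
      show "open ({-\<delta><..<\<delta>} - {0})" by (intro open_Diff) auto
      show "complex_of_real t \<notin> spectrum T" if "t \<in> {-\<delta><..<\<delta>} - {0}" for t
        using \<delta>(2)[of "complex_of_real t"] that by auto
    qed
    have "T (E {0} x) = 0"
    proof -
      \<comment> \<open>\<open>norm_le_on_range\<close> asks for a positive radius, so the one-point
        set is handled by letting r tend to 0.\<close>
      have "norm (T (E {0} x) - 0 *\<^sub>R E {0} x) \<le> r * norm (E {0} x)" if "r > 0" for r
        by (rule norm_le_on_range[of "{0}"]) (use that in \<open>auto simp: E_idem\<close>)
      then have *: "norm (T (E {0} x)) \<le> r * norm (E {0} x)" if "r > 0" for r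
        using that by simp
      have "norm (T (E {0} x)) \<le> 0"
      proof (rule field_le_epsilon)
        fix e :: real assume e: "e > 0"
        have pos: "norm (E {0} x) + 1 > 0" by (simp add: add_nonneg_pos)
        then have "norm (T (E {0} x)) \<le> e / (norm (E {0} x) + 1) * norm (E {0} x)"
          by (intro *) (use e in simp)
        also have "\<dots> \<le> e"
          using e by (simp add: pos_divide_le_eq[OF pos] distrib_left)
        finally show "norm (T (E {0} x)) \<le> 0 + e" by simp
      qed
      then show ?thesis by simp
    qed
    then have "cinner x (E {0} x) = 0" using B(2) by (intro x_span) auto
    then have "rinner x (E {0} x) = 0" by (simp add: rinner_def)
    then have "(norm (E {0} x))\<^sup>2 = 0"
      using norm_E_sq[of "{0}" x] rinner_commute[of "E {0} x" x] by simp
    then have "E {0} x = 0" by simp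
    moreover have "{-\<delta><..<\<delta>} = ({-\<delta><..<\<delta>} - {0}) \<union> {0}" using \<delta>(1) by auto
    ultimately have "E {-\<delta><..<\<delta>} x = 0"
      using E_Un[of "{-\<delta><..<\<delta>} - {0}" "{0}" x] U0 by auto
    then have "E (- {-\<delta><..<\<delta>}) x = x" using E_Compl[of "{-\<delta><..<\<delta>}" x] by simp
    then have "\<delta> * norm x \<le> norm (T x - 0 *\<^sub>R x)"
      by (intro norm_ge_on_range[of "- {-\<delta><..<\<delta>}"]) auto
    then show ?thesis by simp
  qed
  then show thesis using that \<delta>(1) B(1) by blast
qed

end

lemma spectral_resolution_spectral_measure:
  "bounded_selfadjoint T \<Longrightarrow> spectral_resolution T (spectral_measure T)"
  unfolding spectral_resolution_def spectral_measure_def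
  using someI_ex[OF spectral_theorem] by blast

section \<open>Self-adjoint operators with compact products\<close>

lemma bounded_selfadjoint_sum:
  assumes "\<And>i. i \<in> I \<Longrightarrow> bounded_selfadjoint (A i)"
  shows "bounded_selfadjoint (\<lambda>x. \<Sum>i\<in>I. A i x)"
proof (rule bounded_selfadjointI)
  note D = bounded_selfadjointD[OF assms]
  show "bounded_linear (\<lambda>x. \<Sum>i\<in>I. A i x)"
    by (rule bounded_linear_sum) (rule D(1))
  show "(\<Sum>i\<in>I. A i (\<i> *\<^sub>C x)) = \<i> *\<^sub>C (\<Sum>i\<in>I. A i x)" for x
    by (simp add: complex_vector.scale_sum_right D(2) cong: sum.cong)
  show "rinner (\<Sum>i\<in>I. A i x) y = rinner x (\<Sum>i\<in>I. A i y)" for x y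
    by (simp add: rinner.sum_left rinner.sum_right D(4) cong: sum.cong)
qed

text \<open>A finite net of the image of the unit ball under the compact adjoint \<open>K'\<close> consists of vectors
  whose orthogonal complement \<open>K\<close> nearly annihilates.\<close>

lemma compact_operator_small_on_complement:
  assumes K': "compact_operator K'" and adj: "\<And>x y. rinner (K x) y = rinner x (K' y)"
    and \<delta>: "\<delta> > 0"
  obtains B where "finite B" "\<And>y. (\<And>b. b \<in> B \<Longrightarrow> cinner y b = 0) \<Longrightarrow> norm (K y) \<le> \<delta> * norm y"
proof -
  have "seq_compact (closure (K' ` cball 0 1))"
    using K' by (simp add: compact_operator_def compact_eq_seq_compact_metric)
  from seq_compact_imp_totally_bounded[OF this] \<delta>
  obtain B where B: "finite B" "closure (K' ` cball 0 1) \<subseteq> (\<Union>b\<in>B. ball b \<delta>)"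
    by meson
  have "norm (K y) \<le> \<delta> * norm y" if y: "\<And>b. b \<in> B \<Longrightarrow> cinner y b = 0" for y
  proof (cases "K y = 0")
    case True
    then show ?thesis using \<delta> by simp
  next
    case False
    define w where "w = (1 / norm (K y)) *\<^sub>R K y"
    have "w \<in> cball 0 1" using False by (simp add: w_def)
    then have "K' w \<in> closure (K' ` cball 0 1)"
      by (intro subsetD[OF closure_subset] imageI)
    then obtain b where b: "b \<in> B" "norm (K' w - b) < \<delta>"
      using B(2) by (auto simp: dist_norm norm_minus_commute)
    have "norm (K y) = rinner (K y) w"
      using False by (simp add: w_def rinner_scaleR_right rinner_self power2_eq_square)
    also have "\<dots> = rinner y (K' w - b)"
      using y[OF b(1)] by (simp add: adj rinner.diff_right) (simp add: rinner_def)
    also have "\<dots> \<le> norm y * norm (K' w - b)"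
      using rinner_le_norm[of y "K' w - b"] by simp
    also have "\<dots> \<le> norm y * \<delta>"
      using b(2) by (intro mult_left_mono) auto
    finally show ?thesis by (simp add: mult.commute)
  qed
  with B(1) show thesis by (rule that)
qed

locale selfadjoint_family =
  fixes A :: "nat \<Rightarrow> 'a::complex_hilbert_space \<Rightarrow> 'a" and N :: nat
  assumes N: "N > 0"
    and selfadj: "\<And>i. i \<in> {1..N} \<Longrightarrow> bounded_selfadjoint (A i)"
    and compact: "\<And>i j. i \<in> {1..N} \<Longrightarrow> j \<in> {1..N} \<Longrightarrow> i \<noteq> j \<Longrightarrow> compact_operator (A i \<circ> A j)"
begin

lemma resolution: "i \<in> {1..N} \<Longrightarrow> spectral_resolution (A i) (spectral_measure (A i))"
  by (rule spectral_resolution_spectral_measure[OF selfadj])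

lemma total_resolution:
  "spectral_resolution (\<lambda>x. \<Sum>i=1..N. A i x) (spectral_measure (\<lambda>x. \<Sum>i=1..N. A i x))"
  by (rule spectral_resolution_spectral_measure[OF bounded_selfadjoint_sum[OF selfadj]])

lemmas A_linear = bounded_selfadjointD(1)[OF selfadj]
  and A_scaleC = bounded_selfadjointD(2)[OF selfadj]
  and A_csym = bounded_selfadjointD(3)[OF selfadj]
  and A_sym = bounded_selfadjointD(4)[OF selfadj]

text \<open>The adjoint of A_i A_j is A_j A_i, again one of the compact products. Collecting the
  finite sets for all pairs makes the bound uniform.\<close>

lemma products_small_on_complement:
  assumes \<delta>: "\<delta> > 0"
  obtains B where "finite B"
    "\<And>i j y. i \<in> {1..N} \<Longrightarrow> j \<in> {1..N} \<Longrightarrow> i \<noteq> j \<Longrightarrow> (\<And>b. b \<in> B \<Longrightarrow> cinner y b = 0) \<Longrightarrow>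
      norm (A i (A j y)) \<le> \<delta> * norm y"
proof -
  have "\<exists>B. finite B \<and> (\<forall>y. (\<forall>b\<in>B. cinner y b = 0) \<longrightarrow> norm (A i (A j y)) \<le> \<delta> * norm y)"
    if "i \<in> {1..N}" "j \<in> {1..N}" "i \<noteq> j" for i j
    by (rule compact_operator_small_on_complement[OF compact[OF that(2,1)] _ \<delta>, of "\<lambda>y. A i (A j y)"])
      (use that in \<open>auto simp: A_sym\<close>)
  then obtain B where B: "\<And>i j. i \<in> {1..N} \<Longrightarrow> j \<in> {1..N} \<Longrightarrow> i \<noteq> j \<Longrightarrow>
      finite (B i j) \<and> (\<forall>y. (\<forall>b\<in>B i j. cinner y b = 0) \<longrightarrow> norm (A i (A j y)) \<le> \<delta> * norm y)"
    by metis
  show thesis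
  proof (rule that[of "\<Union>i\<in>{1..N}. \<Union>j\<in>{1..N} - {i}. B i j"])
    show "finite (\<Union>i\<in>{1..N}. \<Union>j\<in>{1..N} - {i}. B i j)"
      using B by auto
    show "norm (A i (A j y)) \<le> \<delta> * norm y"
      if "i \<in> {1..N}" "j \<in> {1..N}" "i \<noteq> j" "\<And>b. b \<in> (\<Union>i\<in>{1..N}. \<Union>j\<in>{1..N} - {i}. B i j) \<Longrightarrow> cinner y b = 0"
      for i j y
    proof -
      have "\<forall>b\<in>B i j. cinner y b = 0"
        using that by blast
      then show ?thesis using B[OF that(1-3)] by blast
    qed
  qed
qed

lemma small_spectral_subspace_iff:
  "x \<in> small_spectral_subspace N A \<epsilon> \<longleftrightarrow> (\<forall>i\<in>{1..N}. spectral_measure (A i) {-\<epsilon>..\<epsilon>} x = x)"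
  using spectral_resolution.E_range_iff[OF resolution, of _ "{-\<epsilon>..\<epsilon>}" x]
  by (auto simp: small_spectral_subspace_def)

lemma subspace_small_spectral_subspace: "complex_vector.subspace (small_spectral_subspace N A \<epsilon>)"
  unfolding small_spectral_subspace_def
  by (intro complex_vector.subspace_Inter) (auto intro!: spectral_resolution.subspace_range_E[OF resolution])

section \<open>From infinite-dimensional small spectral subspaces to the essential spectrum\<close>

lemma essential_spectrum_if_infinite_dimensional:
  assumes inf: "\<And>\<epsilon>. \<epsilon> > 0 \<Longrightarrow> infinite_dimensional (small_spectral_subspace N A \<epsilon>)"
  shows "0 \<in> essential_spectrum (\<lambda>x. \<Sum>i=1..N. A i x)"
proof (rule ccontr)
  assume "\<not> ?thesis"
  then obtain \<delta> B where \<delta>: "\<delta> > 0" and B: "finite B"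
    and below: "\<And>x. (\<And>b. b \<in> B \<Longrightarrow> cinner x b = 0) \<Longrightarrow> \<delta> * norm x \<le> norm (\<Sum>i=1..N. A i x)"
    using spectral_resolution.bounded_below_if_not_essential_spectrum[OF total_resolution] by blast
  \<comment> \<open>The \<open>N\<close> summands, each of norm at most \<epsilon> on the subspace,
    add up to \<delta> / 2, strictly below the lower bound \<delta>.\<close>
  define \<epsilon> where "\<epsilon> = \<delta> / (2 * real N)"
  have \<epsilon>: "\<epsilon> > 0" using \<delta> N by (simp add: \<epsilon>_def)
  obtain x where x: "x \<in> small_spectral_subspace N A \<epsilon>" "x \<noteq> 0" "\<And>b. b \<in> B \<Longrightarrow> cinner x b = 0"
    using infinite_dimensional_obtain_orthogonal[OF B subspace_small_spectral_subspace inf[OF \<epsilon>]] by blast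
  have "norm (A i x) \<le> \<epsilon> * norm x" if i: "i \<in> {1..N}" for i
    using spectral_resolution.norm_le_on_range[OF resolution[OF i], of "{-\<epsilon>..\<epsilon>}" 0 \<epsilon> x] x(1) i \<epsilon>
    by (simp add: small_spectral_subspace_iff)
  then have "norm (\<Sum>i=1..N. A i x) \<le> (\<Sum>i=1..N. \<epsilon> * norm x)"
    by (intro sum_norm_le) auto
  also have "\<dots> = \<delta> / 2 * norm x"
    using N by (simp add: \<epsilon>_def)
  finally have "\<delta> * norm x \<le> \<delta> / 2 * norm x"
    using below[OF x(3)] by simp
  then show False using \<delta> x(2) by simp
qed

section \<open>The converse: almost orthogonality of the spectral parts away from zero\<close>

text \<open>Let \<open>Q\<^sub>j = 1 - P\<^sub>j\<close> be the projection onto the part of the spectrum of \<open>A\<^sub>j\<close> away from zero. The space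
  below is, up to finitely many dimensions, the sum of the ranges of the \<open>Q\<^sub>j\<close>; on it these ranges
  are almost orthogonal to each other, because \<open>\<langle>A\<^sub>i v, A\<^sub>j w\<rangle> = \<langle>v, A\<^sub>i A\<^sub>j w\<rangle>\<close>.\<close>

definition large_part :: "real \<Rightarrow> 'a set \<Rightarrow> nat \<Rightarrow> 'a set" where
  "large_part \<epsilon> B j = {w. spectral_measure (A j) (- {-\<epsilon>..\<epsilon>}) w = w \<and> (\<forall>b\<in>B. cinner w b = 0)}"

text \<open>Applying A_j to w_j moves A_j onto the test vector when an inner product is taken, and
  makes compact products appear in the cross terms.\<close>

definition large_sum :: "real \<Rightarrow> 'a set \<Rightarrow> 'a set" where
  "large_sum \<epsilon> B = {s. \<exists>w. (\<forall>j\<in>{1..N}. w j \<in> large_part \<epsilon> B j) \<and> s = (\<Sum>j=1..N. A j (w j))}"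

lemma subspace_large_part:
  assumes j: "j \<in> {1..N}"
  shows "complex_vector.subspace (large_part \<epsilon> B j)"
proof -
  have m: "- {-\<epsilon>..\<epsilon>} \<in> sets (borel :: real measure)" by auto
  interpret spectral_resolution "A j" "spectral_measure (A j)" by (rule resolution[OF j])
  interpret E: bounded_linear "spectral_measure (A j) (- {-\<epsilon>..\<epsilon>})" by (rule E_linear[OF m])
  show ?thesis
    by (auto simp: complex_vector.subspace_def large_part_def E.add E.zero E_scaleC[OF m] cinner_add_left cinner_scaleC_left)
qed

lemma subspace_large_sum: "complex_vector.subspace (large_sum \<epsilon> B)"
  unfolding complex_vector.subspace_def
proof (intro conjI ballI allI)
  note sub = subspace_large_part[of _ \<epsilon> B]
  have "(\<Sum>j=1..N. A j 0) = 0"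
    by (intro sum.neutral ballI) (rule linear_0[OF bounded_linear.linear[OF A_linear]])
  then show "0 \<in> large_sum \<epsilon> B"
    unfolding large_sum_def using complex_vector.subspace_0[OF sub] by (intro CollectI exI[of _ "\<lambda>_. 0"]) auto
  fix s assume "s \<in> large_sum \<epsilon> B"
  then obtain w where w: "\<forall>j\<in>{1..N}. w j \<in> large_part \<epsilon> B j" "s = (\<Sum>j=1..N. A j (w j))"
    unfolding large_sum_def by blast
  show "c *\<^sub>C s \<in> large_sum \<epsilon> B" for c
    unfolding large_sum_def using w complex_vector.subspace_scale[OF sub]
    by (intro CollectI exI[of _ "\<lambda>j. c *\<^sub>C w j"]) (auto simp: complex_vector.scale_sum_right A_scaleC)
  fix s' assume "s' \<in> large_sum \<epsilon> B"
  then obtain w' where w': "\<forall>j\<in>{1..N}. w' j \<in> large_part \<epsilon> B j" "s' = (\<Sum>j=1..N. A j (w' j))"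
    unfolding large_sum_def by blast
  have "(\<Sum>j=1..N. A j (w j + w' j)) = s + s'"
    unfolding w(2) w'(2) sum.distrib[symmetric]
    by (intro sum.cong refl) (rule linear_add[OF bounded_linear.linear[OF A_linear]])
  then show "s + s' \<in> large_sum \<epsilon> B"
    unfolding large_sum_def using w(1) w'(1) complex_vector.subspace_add[OF sub]
    by (intro CollectI exI[of _ "\<lambda>j. w j + w' j"]) auto
qed

lemma large_sum_single:
  assumes j: "j \<in> {1..N}" and v: "v \<in> large_part \<epsilon> B j"
  shows "A j v \<in> large_sum \<epsilon> B"
proof -
  have "(\<Sum>i=1..N. A i (if i = j then v else 0)) = (\<Sum>i=1..N. if i = j then A j v else 0)"
    using linear_0[OF bounded_linear.linear[OF A_linear]] by (intro sum.cong) auto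
  also have "\<dots> = A j v" using j by simp
  finally have "A j v = (\<Sum>i=1..N. A i (if i = j then v else 0))" by simp
  moreover have "\<forall>i\<in>{1..N}. (if i = j then v else 0) \<in> large_part \<epsilon> B i"
    using v complex_vector.subspace_0[OF subspace_large_part] by simp
  ultimately show ?thesis
    unfolding large_sum_def by (intro CollectI exI[of _ "\<lambda>i. if i = j then v else 0"] conjI)
qed

text \<open>Expand the squared norm of the sum. The diagonal terms contribute at least \<epsilon>^2
  times the sum of squares, and by Cauchy-Schwarz the bound on the products is chosen so that the
  cross terms consume at most half of this.\<close>

lemma large_sum_coercive:
  assumes \<epsilon>: "\<epsilon> > 0"
    and B: "\<And>i j y. i \<in> {1..N} \<Longrightarrow> j \<in> {1..N} \<Longrightarrow> i \<noteq> j \<Longrightarrow> (\<And>b. b \<in> B \<Longrightarrow> cinner y b = 0) \<Longrightarrow>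
      norm (A i (A j y)) \<le> \<epsilon>\<^sup>2 / (2 * N) * norm y"
    and w: "\<forall>j\<in>{1..N}. w j \<in> large_part \<epsilon> B j"
  shows "(\<Sum>j=1..N. norm (w j)) \<le> 2 * N / \<epsilon> * norm (\<Sum>j=1..N. A j (w j))"
proof -
  define \<delta> where "\<delta> = \<epsilon>\<^sup>2 / (2 * N)"
  define s where "s = (\<Sum>j=1..N. A j (w j))"
  have diag: "\<epsilon>\<^sup>2 * (norm (w j))\<^sup>2 \<le> rinner (A j (w j)) (A j (w j))" if j: "j \<in> {1..N}" for j
  proof -
    have "\<epsilon> * norm (w j) \<le> norm (A j (w j) - 0 *\<^sub>R w j)"
      by (rule spectral_resolution.norm_ge_on_range[OF resolution[OF j], of "- {-\<epsilon>..\<epsilon>}"])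
        (use w j in \<open>auto simp: large_part_def\<close>)
    then have "(\<epsilon> * norm (w j))\<^sup>2 \<le> (norm (A j (w j)))\<^sup>2"
      using \<epsilon> by (intro power_mono) auto
    then show ?thesis by (simp add: rinner_self power_mult_distrib)
  qed
  have off: "- (\<delta> * (norm (w i) * norm (w j))) \<le> rinner (A i (w i)) (A j (w j))"
    if ij: "i \<in> {1..N}" "j \<in> {1..N}" "i \<noteq> j" for i j
  proof -
    have "\<bar>rinner (A i (w i)) (A j (w j))\<bar> \<le> norm (w i) * norm (A i (A j (w j)))"
      unfolding A_sym[OF ij(1)] by (rule rinner_le_norm)
    also have "\<dots> \<le> norm (w i) * (\<delta> * norm (w j))"
      unfolding \<delta>_def using w ij by (intro mult_left_mono B) (auto simp: large_part_def)
    finally show ?thesis by (simp add: mult_ac)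
  qed
  have square: "(\<Sum>j=1..N. norm (w j))\<^sup>2 = (\<Sum>i=1..N. \<Sum>j=1..N. norm (w i) * norm (w j))"
    by (simp add: power2_eq_square sum_product)
  have \<delta>_pos: "\<delta> \<ge> 0" by (simp add: \<delta>_def)
  \<comment> \<open>The correction is subtracted on the diagonal too, so that it sums to a full
    square.\<close>
  have "(\<Sum>i=1..N. \<Sum>j=1..N. (if i = j then \<epsilon>\<^sup>2 * (norm (w j))\<^sup>2 else 0) - \<delta> * (norm (w i) * norm (w j)))
      \<le> (\<Sum>i=1..N. \<Sum>j=1..N. rinner (A i (w i)) (A j (w j)))"
  proof (intro sum_mono)
    fix i j assume ij: "i \<in> {1..N}" "j \<in> {1..N}"
    have "0 \<le> \<delta> * (norm (w i) * norm (w j))" using \<delta>_pos by simp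
    then show "(if i = j then \<epsilon>\<^sup>2 * (norm (w j))\<^sup>2 else 0) - \<delta> * (norm (w i) * norm (w j)) \<le> rinner (A i (w i)) (A j (w j))"
      using diag[OF ij(2)] off[OF ij] by (cases "i = j") auto
  qed
  also have "\<dots> = (norm s)\<^sup>2"
    unfolding rinner_self[symmetric] s_def rinner.sum_left unfolding rinner.sum_right ..
  finally have "\<epsilon>\<^sup>2 * (\<Sum>j=1..N. (norm (w j))\<^sup>2) - \<delta> * (\<Sum>j=1..N. norm (w j))\<^sup>2 \<le> (norm s)\<^sup>2"
    unfolding square by (simp add: sum_subtractf sum_distrib_left)
  moreover have cs: "(\<Sum>j=1..N. norm (w j))\<^sup>2 \<le> N * (\<Sum>j=1..N. (norm (w j))\<^sup>2)"
    using sum_squared_le_sum_of_squares[of "\<lambda>j. norm (w j)" "{1..N}"] by (simp add: mult.commute)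
  then have "\<epsilon>\<^sup>2 / N * (\<Sum>j=1..N. norm (w j))\<^sup>2 \<le> \<epsilon>\<^sup>2 / N * (N * (\<Sum>j=1..N. (norm (w j))\<^sup>2))"
    by (intro mult_left_mono) auto
  ultimately have "\<delta> * (\<Sum>j=1..N. norm (w j))\<^sup>2 \<le> (norm s)\<^sup>2"
    using N by (simp add: \<delta>_def)
  then have "(\<Sum>j=1..N. norm (w j))\<^sup>2 \<le> 2 * N / \<epsilon>\<^sup>2 * (norm s)\<^sup>2"
    using \<epsilon> N by (simp add: \<delta>_def field_simps)
  \<comment> \<open>The constant is enlarged to a perfect square to avoid a square root.\<close>
  also have "\<dots> \<le> (2 * N)\<^sup>2 / \<epsilon>\<^sup>2 * (norm s)\<^sup>2"
    using N by (intro mult_right_mono divide_right_mono) (auto simp: power2_eq_square)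
  also have "\<dots> = (2 * N / \<epsilon> * norm s)\<^sup>2"
    by (simp add: power_mult_distrib power_divide)
  finally show ?thesis
    unfolding s_def[symmetric] by (rule power2_le_imp_le) (use \<epsilon> in simp)
qed

text \<open>For z orthogonal to \<open>large_sum\<close> and to the vectors A_j Q_j b with b in
  \<open>B\<close>, the vector v = A_j Q_j z lies in \<open>large_part\<close>. Hence 0 =
  \<langle>z, A_j v\<rangle> = \<langle>v, v\<rangle> and Q_j z = 0, for every j, so z is in the
  small spectral subspace. Infinite dimension would allow z to be nonzero and orthogonal to a finite
  set spanning that subspace as well.\<close>

lemma finite_dimensional_orthogonal_large_sum:
  assumes \<epsilon>: "\<epsilon> > 0" and B: "finite B"
    and fin: "\<not> infinite_dimensional (small_spectral_subspace N A \<epsilon>)"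
  shows "\<not> infinite_dimensional {z. \<forall>s\<in>large_sum \<epsilon> B. cinner z s = 0}"
proof
  define Z where "Z = {z. \<forall>s\<in>large_sum \<epsilon> B. cinner z s = 0}"
  define Q where "Q j = spectral_measure (A j) (- {-\<epsilon>..\<epsilon>})" for j
  assume inf: "infinite_dimensional {z. \<forall>s\<in>large_sum \<epsilon> B. cinner z s = 0}"
  obtain C where C: "finite C" "small_spectral_subspace N A \<epsilon> \<subseteq> complex_vector.span C"
    using fin unfolding infinite_dimensional_def by blast
  have sub: "complex_vector.subspace Z"
    by (auto simp: Z_def complex_vector.subspace_def cinner_add_left cinner_scaleC_left)
  have fin': "finite (C \<union> (\<Union>j\<in>{1..N}. (\<lambda>b. A j (Q j b)) ` B))"
    using B C(1) by auto
  obtain z where z: "z \<in> Z" "z \<noteq> 0"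
    and zC: "\<And>g. g \<in> C \<union> (\<Union>j\<in>{1..N}. (\<lambda>b. A j (Q j b)) ` B) \<Longrightarrow> cinner z g = 0"
    by (rule infinite_dimensional_obtain_orthogonal[OF fin' sub inf[folded Z_def]], rule that)
  have "spectral_measure (A j) {-\<epsilon>..\<epsilon>} z = z" if j: "j \<in> {1..N}" for j
  proof -
    have m: "- {-\<epsilon>..\<epsilon>} \<in> sets (borel :: real measure)" by auto
    interpret spectral_resolution "A j" "spectral_measure (A j)" by (rule resolution[OF j])
    define v where "v = A j (Q j z)"
    have comm: "A j (Q j y) = Q j (A j y)" for y
      by (simp add: Q_def E_T_commute[OF m])
    have Qv: "Q j v = v"
      unfolding v_def comm by (simp add: Q_def E_idem[OF m])
    have "cinner v b = 0" if "b \<in> B" for b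
    proof -
      have "cinner v b = cinner (Q j z) (A j b)" by (simp add: v_def A_csym[OF j])
      also have "\<dots> = cinner z (A j (Q j b))" unfolding comm by (simp add: Q_def E_csym[OF m])
      also have "\<dots> = 0" using zC that j by blast
      finally show ?thesis .
    qed
    then have "v \<in> large_part \<epsilon> B j"
      using Qv by (simp add: large_part_def Q_def)
    then have "cinner z (A j v) = 0"
      using z(1) large_sum_single[OF j] by (simp add: Z_def)
    moreover have "cinner z (A j v) = cinner v v"
    proof -
      have "cinner z (A j v) = cinner (A j z) (Q j v)" by (simp add: A_csym[OF j] Qv)
      also have "\<dots> = cinner v v" unfolding v_def comm by (simp add: Q_def E_csym[OF m] E_idem[OF m])
      finally show ?thesis .
    qed
    ultimately have "v = 0" by (simp add: cinner_self)
    moreover have "\<epsilon> * norm (Q j z) \<le> norm (A j (Q j z) - 0 *\<^sub>R Q j z)"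
      by (rule norm_ge_on_range[OF m]) (auto simp: Q_def E_idem[OF m])
    ultimately have "Q j z = 0" using \<epsilon> by (simp add: v_def mult_le_0_iff)
    then show ?thesis using E_Compl[of "{-\<epsilon>..\<epsilon>}" z] by (simp add: Q_def)
  qed
  then have "z \<in> complex_vector.span C"
    using C(2) by (auto simp: small_spectral_subspace_iff)
  then have "cinner z z = 0"
    by (rule cinner_span_eq_0) (simp add: zC)
  then show False using z(2) by (simp add: cinner_self)
qed

text \<open>The squared norm of A_j x is \<langle>x, A_j A_j x\<rangle>, and A_j A_j x = A_j A x
  minus the products A_j A_i x with i distinct from j; all these terms are small for a suitable x in
  a spectral subspace of A near 0.\<close>

lemma approximate_null_vector:
  assumes ess: "0 \<in> essential_spectrum (\<lambda>x. \<Sum>i=1..N. A i x)" and \<kappa>: "\<kappa> > 0" and G: "finite G"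
  obtains x where "x \<noteq> 0" "\<And>g. g \<in> G \<Longrightarrow> cinner x g = 0" "\<And>j. j \<in> {1..N} \<Longrightarrow> norm (A j x) \<le> \<kappa> * norm x"
proof -
  have "\<exists>K>0. \<forall>x. norm (A j x) \<le> norm x * K" if "j \<in> {1..N}" for j
    using bounded_linear.pos_bounded[OF A_linear[OF that]] .
  then obtain K where K: "\<And>j. j \<in> {1..N} \<Longrightarrow> K j > 0" "\<And>j x. j \<in> {1..N} \<Longrightarrow> norm (A j x) \<le> norm x * K j"
    by metis
  define L where "L = (\<Sum>j=1..N. K j)"
  have KL: "K j \<le> L" if "j \<in> {1..N}" for j
    unfolding L_def using that K(1) by (intro member_le_sum) (auto intro: less_imp_le)
  have L: "L \<ge> 0" unfolding L_def using K(1) by (intro sum_nonneg) (auto intro: less_imp_le)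
  \<comment> \<open>\<open>L\<close> dominates the bounds of all A_j and at most \<open>N\<close>
    products occur, so the total error (L + N) \<eta> is exactly \<kappa>^2.\<close>
  define \<eta> where "\<eta> = \<kappa>\<^sup>2 / (L + N)"
  have \<eta>: "\<eta> > 0" using \<kappa> L N by (simp add: \<eta>_def)
  obtain B where B: "finite B" "\<And>i j y. i \<in> {1..N} \<Longrightarrow> j \<in> {1..N} \<Longrightarrow> i \<noteq> j \<Longrightarrow> (\<And>b. b \<in> B \<Longrightarrow> cinner y b = 0) \<Longrightarrow>
      norm (A i (A j y)) \<le> \<eta> * norm y"
    using products_small_on_complement[OF \<eta>] by blast
  interpret S: spectral_resolution "\<lambda>x. \<Sum>i=1..N. A i x" "spectral_measure (\<lambda>x. \<Sum>i=1..N. A i x)"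
    by (rule total_resolution)
  obtain x where x: "x \<in> range (spectral_measure (\<lambda>x. \<Sum>i=1..N. A i x) {-\<eta>..\<eta>})" "x \<noteq> 0"
      "\<And>g. g \<in> G \<union> B \<Longrightarrow> cinner x g = 0"
    using infinite_dimensional_obtain_orthogonal[of "G \<union> B", OF _ S.subspace_range_E S.infinite_dimensional_range_if_essential_spectrum[OF ess \<eta>]]
      G B(1) by auto
  have Ax: "norm (\<Sum>i=1..N. A i x) \<le> \<eta> * norm x"
  proof -
    have "spectral_measure (\<lambda>x. \<Sum>i=1..N. A i x) {-\<eta>..\<eta>} x = x"
      by (rule iffD1[OF S.E_range_iff x(1)]) simp
    then show ?thesis
      using S.norm_le_on_range[of "{-\<eta>..\<eta>}" 0 \<eta> x] \<eta> by simp
  qed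
  have "norm (A j x) \<le> \<kappa> * norm x" if j: "j \<in> {1..N}" for j
  proof (rule power2_le_imp_le)
    interpret A: bounded_linear "A j" by (rule A_linear[OF j])
    have "A j (\<Sum>i=1..N. A i x) = A j (A j x) + (\<Sum>i\<in>{1..N} - {j}. A j (A i x))"
      using j by (simp add: sum.remove A.add A.sum)
    then have "norm (A j (A j x)) \<le> norm (A j (\<Sum>i=1..N. A i x)) + norm (\<Sum>i\<in>{1..N} - {j}. A j (A i x))"
      using norm_triangle_ineq4[of "A j (\<Sum>i=1..N. A i x)" "\<Sum>i\<in>{1..N} - {j}. A j (A i x)"] by simp
    also have "norm (A j (\<Sum>i=1..N. A i x)) \<le> (\<eta> * norm x) * L"
      using K(2)[OF j, of "\<Sum>i=1..N. A i x"] Ax KL[OF j] K(1)[OF j]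
      by (smt (verit, best) mult_mono norm_ge_zero)
    also have "norm (\<Sum>i\<in>{1..N} - {j}. A j (A i x)) \<le> (\<Sum>i\<in>{1..N} - {j}. \<eta> * norm x)"
      using B(2)[OF j] x(3) by (intro sum_norm_le) auto
    also have "\<dots> \<le> N * (\<eta> * norm x)"
      using \<eta> card_Diff1_le[of "{1..N}" j] by (simp add: mult_right_mono)
    also have "(\<eta> * norm x) * L + N * (\<eta> * norm x) = (\<eta> * (L + N)) * norm x"
      by (simp add: algebra_simps)
    also have "\<eta> * (L + N) = \<kappa>\<^sup>2"
      using L N by (simp add: \<eta>_def)
    finally have "norm (A j (A j x)) \<le> \<kappa>\<^sup>2 * norm x" by simp
    have "(norm (A j x))\<^sup>2 = rinner x (A j (A j x))"
      by (simp add: A_sym[OF j] flip: rinner_self)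
    also have "\<dots> \<le> norm x * norm (A j (A j x))"
      using rinner_le_norm[of x "A j (A j x)"] by simp
    also have "\<dots> \<le> norm x * (\<kappa>\<^sup>2 * norm x)"
      by (intro mult_left_mono \<open>norm (A j (A j x)) \<le> \<kappa>\<^sup>2 * norm x\<close>) simp
    finally show "(norm (A j x))\<^sup>2 \<le> (\<kappa> * norm x)\<^sup>2"
      by (simp add: power2_eq_square mult_ac)
  qed (use \<kappa> in simp)
  then show thesis using x by (intro that[of x]) auto
qed

lemma infinite_dimensional_if_essential_spectrum:
  assumes ess: "0 \<in> essential_spectrum (\<lambda>x. \<Sum>i=1..N. A i x)" and \<epsilon>: "\<epsilon> > 0"
  shows "infinite_dimensional (small_spectral_subspace N A \<epsilon>)"
proof (rule ccontr)
  assume fin: "\<not> ?thesis"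
  have "\<epsilon>\<^sup>2 / (2 * N) > 0" using \<epsilon> N by simp
  then obtain B where B: "finite B" "\<And>i j y. i \<in> {1..N} \<Longrightarrow> j \<in> {1..N} \<Longrightarrow> i \<noteq> j \<Longrightarrow> (\<And>b. b \<in> B \<Longrightarrow> cinner y b = 0) \<Longrightarrow>
      norm (A i (A j y)) \<le> \<epsilon>\<^sup>2 / (2 * N) * norm y"
    using products_small_on_complement by blast
  define S where "S = large_sum \<epsilon> B"
  obtain G where G: "finite G" "{z. \<forall>s\<in>S. cinner z s = 0} \<subseteq> complex_vector.span G"
    using finite_dimensional_orthogonal_large_sum[OF \<epsilon> B(1) fin] unfolding infinite_dimensional_def S_def by blast
  \<comment> \<open>Together with the coercivity constant 2 N / \<epsilon> this gives the factor 1 /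
    2 in \<open>small\<close>.\<close>
  define \<kappa> where "\<kappa> = \<epsilon> / (4 * N)"
  have \<kappa>: "\<kappa> > 0" using \<epsilon> N by (simp add: \<kappa>_def)
  obtain x where x: "x \<noteq> 0" "\<And>g. g \<in> G \<Longrightarrow> cinner x g = 0" "\<And>j. j \<in> {1..N} \<Longrightarrow> norm (A j x) \<le> \<kappa> * norm x"
    using approximate_null_vector[OF ess \<kappa> G(1)] by blast
  have small: "rinner x s \<le> norm x * norm s / 2" if s: "s \<in> S" for s
  proof -
    obtain w where w: "\<forall>j\<in>{1..N}. w j \<in> large_part \<epsilon> B j" "s = (\<Sum>j=1..N. A j (w j))"
      using s unfolding S_def large_sum_def by blast
    have "rinner x s = (\<Sum>j=1..N. rinner (A j x) (w j))"
      unfolding w(2) rinner.sum_right by (intro sum.cong refl) (simp add: A_sym)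
    also have "\<dots> \<le> (\<Sum>j=1..N. (\<kappa> * norm x) * norm (w j))"
    proof (rule sum_mono)
      fix j assume j: "j \<in> {1..N}"
      have "rinner (A j x) (w j) \<le> norm (A j x) * norm (w j)"
        using rinner_le_norm[of "A j x" "w j"] by simp
      also have "\<dots> \<le> (\<kappa> * norm x) * norm (w j)"
        using x(3)[OF j] by (rule mult_right_mono) simp
      finally show "rinner (A j x) (w j) \<le> (\<kappa> * norm x) * norm (w j)" .
    qed
    also have "\<dots> = (\<kappa> * norm x) * (\<Sum>j=1..N. norm (w j))"
      by (simp add: sum_distrib_left)
    also have "\<dots> \<le> (\<kappa> * norm x) * (2 * N / \<epsilon> * norm s)"
      unfolding w(2) using \<kappa> by (intro mult_left_mono large_sum_coercive[OF \<epsilon> B(2) w(1)]) auto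
    also have "\<dots> = norm x * norm s / 2"
      using \<epsilon> N by (simp add: \<kappa>_def)
    finally show ?thesis .
  qed
  \<comment> \<open>The projection of x is only known to lie in the closure of \<open>S\<close>, so
    the estimate has to be extended there.\<close>
  have "closed {s. rinner x s \<le> norm x * norm s / 2}"
    by (intro closed_Collect_le continuous_intros bounded_linear.continuous_on[OF rinner.bounded_linear_right]) auto
  then have small_closure: "closure S \<subseteq> {s. rinner x s \<le> norm x * norm s / 2}"
    using small by (intro closure_minimal) auto
  have csub: "complex_vector.subspace S"
    unfolding S_def by (rule subspace_large_sum)
  obtain u where u: "u \<in> closure S" "\<And>m. m \<in> closure S \<Longrightarrow> rinner (x - u) m = 0"
    using projection_exists[OF subspace_closure[OF real_subspaceI[OF csub]] closed_closure] by blast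
  \<comment> \<open>The projection is taken in the real inner product; complex orthogonality follows
    because \<open>S\<close> is stable under \<i>.\<close>
  have "cinner (x - u) s = 0" if "s \<in> S" for s
  proof -
    have "s \<in> closure S" "\<i> *\<^sub>C s \<in> closure S"
      using that complex_vector.subspace_scale[OF csub that, of \<i>] closure_subset[of S] by blast+
    then show ?thesis
      using u(2) by (simp add: cinner_eq_rinner complex_eq_iff)
  qed
  then have "x - u \<in> complex_vector.span G"
    using G(2) by blast
  \<comment> \<open>The residual x - u is in the span of \<open>G\<close>, to which x was chosen
    orthogonal, and u is orthogonal to the residual as well; so x = u lies in the closure of
    \<open>S\<close>, where \<open>small\<close> contradicts x being nonzero.\<close>
  then have "cinner x (x - u) = 0"
    by (rule cinner_span_eq_0) (rule x(2))
  then have "rinner x (x - u) = 0" by (simp add: rinner_def)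
  moreover have "rinner u (x - u) = 0"
    by (subst rinner_commute) (rule u(2)[OF u(1)])
  ultimately have "rinner (x - u) (x - u) = 0"
    by (simp only: rinner.diff_left[of x u "x - u"])
  then have "x = u" by (simp add: rinner_self)
  then have "rinner x x \<le> norm x * norm x / 2"
    using small_closure u(1) by blast
  then show False using x(1) by (simp add: rinner_self power2_eq_square)
qed

end

theorem mainTheorem1:
  fixes A :: "nat \<Rightarrow> 'a::complex_hilbert_space \<Rightarrow> 'a" and N :: nat
  assumes "N \<ge> 2"
    and "\<And>i. i \<in> {1..N} \<Longrightarrow> bounded_selfadjoint (A i)"
    and "\<And>i j. i \<in> {1..N} \<Longrightarrow> j \<in> {1..N} \<Longrightarrow> i \<noteq> j \<Longrightarrow> compact_operator (A i \<circ> A j)"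
  shows "0 \<in> essential_spectrum (\<lambda>x. \<Sum>i=1..N. A i x) \<longleftrightarrow>
    (\<forall>\<epsilon>>0. infinite_dimensional (small_spectral_subspace N A \<epsilon>))"
proof -
  interpret selfadjoint_family A N
    using assms by unfold_locales auto
  show ?thesis
    using essential_spectrum_if_infinite_dimensional infinite_dimensional_if_essential_spectrum by blast
qed

end
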